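(* Let $p,q\in\mathbb{F}[t]$ be monic polynomials of degree $2$. Assume that $p$ is irreducible over $\mathbb{F}$ and that $q(t)=(t-y_1)(t-y_2)$ for scalars $y_1,y_2\in\mathbb{F}$ such that $p(t+y_1)\neq p(t+y_2)$. Let $v$ be a $(p,q)$-exceptional endomorphism of a vector space $V$ over $\mathbb{F}$. The following conditions are equivalent: (i) $S(v)$ is a symplectic $(p,q)$-difference; (ii) $h(v)$ is a $(p,q)$-difference in $\operatorname{End}(V\times V^\star)$; (iii) $v$ is a $(p,q)$-difference in $\operatorname{End}(V)$; (iv) the sequences $\bigl(n_k(v,p(t+y_1))\bigr)_{k\geq1}$ and $\bigl(n_k(v,p(t+y_2))\bigr)_{k\geq1}$ are $1$-intertwined.
   Context: $\mathbb{F}$ is an arbitrary field (characteristic $2$ allowed), with a fixed algebraic closure $\overline{\mathbb{F}}$; all vector spaces are finite-dimensional over $\mathbb{F}$. $\operatorname{Root}(r)$ is the set of roots of $r$ in $\overline{\mathbb{F}}$; $\operatorname{Root}(p)-\operatorname{Root}(q):=\{x-y : x\in\operatorname{Root}(p),\,y\in\operatorname{Root}(q)\}$. An endomorphism is $(p,q)$-exceptional if all its eigenvalues in $\overline{\mathbb{F}}$ belong to $\operatorname{Root}(p)-\operatorname{Root}(q)$. An element $a$ of an $\mathbb{F}$-algebra $\mathcal{A}$ is a $(p,q)$-difference in $\mathcal{A}$ if $a=a_1-a_2$ for some $a_1,a_2\in\mathcal{A}$ with $p(a_1)=0=q(a_2)$. For an endomorphism $u$, a monic irreducible $r\in\mathbb{F}[t]$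 and $k\ge1$, $n_k(u,r)$ is the number of primary invariants (elementary divisors) of $u$ of the form $r^l$ with $l\ge k$. For a positive integer $m$, two non-increasing sequences $(a_n)_{n\ge1}$, $(b_n)_{n\ge1}$ of non-negative integers are $m$-intertwined if $a_{n+m}\le b_n$ and $b_{n+m}\le a_n$ for all $n\ge1$. A symplectic form is a non-degenerate alternating bilinear form. Given a symplectic form $b$ on $V$, an endomorphism $u$ of $V$ is $b$-alternating if $b(x,u(x))=0$ for all $x\in V$. A symplectic pair $(b,u)$ consists of a symplectic form $b$ on a vector space and a $b$-alternating endomorphism $u$ of it. It is a symplectic $(p,q)$-difference if there are $b$-alternating endomorphisms $u_1,u_2$ with $u=u_1-u_2$, $p(u_1)=0$ and $q(u_2)=0$. For an endomorphism $v$ of $V$ with transpose $v^t:\varphi\mapsto\varphi\circ v$ on the dual space $V^\star$, put $h(v):=v\oplus v^t$ on $V\times V^\star$ and $S_V((x,\varphi),(y,\psi)):=\varphi(y)-\psi(x)$. The symplectic extension of $v$ is the symplectic pair $S(v):=(S_V,h(v))$. *)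

theory Defs
  imports
    Complex_Main
    "HOL-Algebra.Algebraic_Closure_Type"
    "HOL-Computational_Algebra.Polynomial"
    "HOL-Library.Function_Algebras"
    "HOL-Library.Product_Plus"
    "HOL-Library.Multiset"
begin

text \<open>
  A vector space is given by a scalar multiplication \<open>s\<close> on a type of class
  \<^class>\<open>ab_group_add\<close> and a subspace \<open>W\<close> of that type serving as carrier. Carriers other than
  \<^term>\<open>UNIV\<close> are needed because the linear forms are only a part of the type of all functions.
  Maps on \<open>W\<close> are represented by functions on the whole type whose values outside \<open>W\<close> are
  irrelevant; equality of maps is therefore always equality on \<open>W\<close>.
\<close>

definition End_on :: "('a::field \<Rightarrow> 'c::ab_group_add \<Rightarrow> 'c) \<Rightarrow> 'c set \<Rightarrow> ('c \<Rightarrow> 'c) set" where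
  "End_on s W = {u. (\<forall>x\<in>W. u x \<in> W)
                  \<and> (\<forall>x\<in>W. \<forall>y\<in>W. u (x + y) = u x + u y)
                  \<and> (\<forall>c. \<forall>x\<in>W. u (s c x) = s c (u x))}"

definition poly_end ::
    "('a::field \<Rightarrow> 'c::ab_group_add \<Rightarrow> 'c) \<Rightarrow> 'a poly \<Rightarrow> ('c \<Rightarrow> 'c) \<Rightarrow> 'c \<Rightarrow> 'c" where
  "poly_end s f u x = (\<Sum>i\<le>degree f. s (coeff f i) ((u ^^ i) x))"

definition is_pq_difference_in_End ::
    "'a::field poly \<Rightarrow> 'a poly \<Rightarrow> ('a \<Rightarrow> 'c::ab_group_add \<Rightarrow> 'c) \<Rightarrow> 'c set \<Rightarrow> ('c \<Rightarrow> 'c) \<Rightarrow> bool" where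
  "is_pq_difference_in_End p q s W u \<longleftrightarrow>
     (\<exists>u1\<in>End_on s W. \<exists>u2\<in>End_on s W.
        (\<forall>x\<in>W. u x = u1 x - u2 x)
      \<and> (\<forall>x\<in>W. poly_end s p u1 x = 0)
      \<and> (\<forall>x\<in>W. poly_end s q u2 x = 0))"


definition Root :: "'a::field poly \<Rightarrow> 'a alg_closure set" where
  "Root r = {x. poly (map_poly to_ac r) x = 0}"

text \<open>
  The eigenvalues of \<open>u\<close> in the algebraic closure are those of its scalar extension. With respect
  to a finite basis \<open>B\<close>, a vector of the scalar extension is a coordinate family \<open>c\<close> indexed
  by \<open>B\<close>, and the extension of \<open>u\<close> acts on it through the matrix of \<open>u\<close> in \<open>B\<close>, whose
  \<open>(i, j)\<close> entry is \<open>module.representation s B (u j) i\<close>.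
\<close>

definition eigenvalues_ac ::
    "('a::field \<Rightarrow> 'b::ab_group_add \<Rightarrow> 'b) \<Rightarrow> 'b set \<Rightarrow> ('b \<Rightarrow> 'b) \<Rightarrow> 'a alg_closure set" where
  "eigenvalues_ac s B u =
     {z. \<exists>c :: 'b \<Rightarrow> 'a alg_closure.
           (\<exists>i\<in>B. c i \<noteq> 0)
         \<and> (\<forall>i\<in>B. (\<Sum>j\<in>B. to_ac (module.representation s B (u j) i) * c j) = z * c i)}"

definition pq_exceptional ::
    "'a::field poly \<Rightarrow> 'a poly \<Rightarrow> ('a \<Rightarrow> 'b::ab_group_add \<Rightarrow> 'b) \<Rightarrow> 'b set \<Rightarrow> ('b \<Rightarrow> 'b) \<Rightarrow> bool" where
  "pq_exceptional p q s B u \<longleftrightarrow>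
     eigenvalues_ac s B u \<subseteq> {x - y | x y. x \<in> Root p \<and> y \<in> Root q}"


text \<open>
  The family \<open>ds\<close> of powers of monic irreducible polynomials is a family of elementary divisors
  of \<open>u\<close> when the \<open>F[t]\<close>-module that \<open>u\<close> defines on \<open>W\<close> is isomorphic to the direct sum of the
  \<open>F[t]/(d)\<close> for \<open>d\<close> in \<open>ds\<close>. The last two conjuncts say that the module homomorphism from
  \<open>F[t]^m\<close> to \<open>W\<close>, sending \<open>f\<close> to the sum of the \<open>f\<^sub>i(u)(xs\<^sub>i)\<close>, is onto and has
  kernel the product of the ideals \<open>(ds\<^sub>i)\<close>.
\<close>

definition is_primary_decomposition ::
    "('a::field \<Rightarrow> 'c::ab_group_add \<Rightarrow> 'c) \<Rightarrow> 'c set \<Rightarrow> ('c \<Rightarrow> 'c) \<Rightarrow> 'c list \<Rightarrow> 'a poly list \<Rightarrow> bool"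
  where
  "is_primary_decomposition s W u xs ds \<longleftrightarrow>
     length xs = length ds
   \<and> set xs \<subseteq> W
   \<and> (\<forall>d\<in>set ds. \<exists>r l. irreducible r \<and> lead_coeff r = 1 \<and> l \<ge> 1 \<and> d = r ^ l)
   \<and> (\<forall>x\<in>W. \<exists>f :: nat \<Rightarrow> 'a poly. x = (\<Sum>i<length ds. poly_end s (f i) u (xs ! i)))
   \<and> (\<forall>f :: nat \<Rightarrow> 'a poly.
        (\<Sum>i<length ds. poly_end s (f i) u (xs ! i)) = 0 \<longleftrightarrow> (\<forall>i<length ds. ds ! i dvd f i))"

definition elementary_divisors ::
    "('a::field \<Rightarrow> 'c::ab_group_add \<Rightarrow> 'c) \<Rightarrow> 'c set \<Rightarrow> ('c \<Rightarrow> 'c) \<Rightarrow> 'a poly multiset" where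
  "elementary_divisors s W u =
     (THE M. \<exists>xs ds. is_primary_decomposition s W u xs ds \<and> M = mset ds)"

definition n_elem_div ::
    "('a::field \<Rightarrow> 'c::ab_group_add \<Rightarrow> 'c) \<Rightarrow> 'c set \<Rightarrow> ('c \<Rightarrow> 'c) \<Rightarrow> 'a poly \<Rightarrow> nat \<Rightarrow> nat" where
  "n_elem_div s W u r k = size {# d \<in># elementary_divisors s W u. \<exists>l\<ge>k. d = r ^ l #}"

text \<open>Sequences are indexed by the positive integers; the value at \<open>0\<close> is ignored.\<close>

definition intertwined :: "nat \<Rightarrow> (nat \<Rightarrow> nat) \<Rightarrow> (nat \<Rightarrow> nat) \<Rightarrow> bool" where
  "intertwined m a b \<longleftrightarrow> (\<forall>n\<ge>1. a (n + m) \<le> b n \<and> b (n + m) \<le> a n)"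


definition symplectic_form ::
    "('a::field \<Rightarrow> 'c::ab_group_add \<Rightarrow> 'c) \<Rightarrow> 'c set \<Rightarrow> ('c \<Rightarrow> 'c \<Rightarrow> 'a) \<Rightarrow> bool" where
  "symplectic_form s W b \<longleftrightarrow>
     (\<forall>x\<in>W. \<forall>y\<in>W. \<forall>z\<in>W. b (x + y) z = b x z + b y z \<and> b z (x + y) = b z x + b z y)
   \<and> (\<forall>c. \<forall>x\<in>W. \<forall>y\<in>W. b (s c x) y = c * b x y \<and> b x (s c y) = c * b x y)
   \<and> (\<forall>x\<in>W. b x x = 0)
   \<and> (\<forall>x\<in>W. (\<forall>y\<in>W. b x y = 0) \<longrightarrow> x = 0)"

definition alternating_End ::
    "('a::field \<Rightarrow> 'c::ab_group_add \<Rightarrow> 'c) \<Rightarrow> 'c set \<Rightarrow> ('c \<Rightarrow> 'c \<Rightarrow> 'a) \<Rightarrow> ('c \<Rightarrow> 'c) set" where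
  "alternating_End s W b = {u \<in> End_on s W. \<forall>x\<in>W. b x (u x) = 0}"

definition symplectic_pair ::
    "('a::field \<Rightarrow> 'c::ab_group_add \<Rightarrow> 'c) \<Rightarrow> 'c set \<Rightarrow> ('c \<Rightarrow> 'c \<Rightarrow> 'a) \<times> ('c \<Rightarrow> 'c) \<Rightarrow> bool" where
  "symplectic_pair s W = (\<lambda>(b, u). symplectic_form s W b \<and> u \<in> alternating_End s W b)"

definition is_symplectic_pq_difference ::
    "'a::field poly \<Rightarrow> 'a poly \<Rightarrow> ('a \<Rightarrow> 'c::ab_group_add \<Rightarrow> 'c) \<Rightarrow> 'c set \<Rightarrow>
       ('c \<Rightarrow> 'c \<Rightarrow> 'a) \<times> ('c \<Rightarrow> 'c) \<Rightarrow> bool" where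
  "is_symplectic_pq_difference p q s W = (\<lambda>(b, u).
     symplectic_pair s W (b, u)
   \<and> (\<exists>u1\<in>alternating_End s W b. \<exists>u2\<in>alternating_End s W b.
        (\<forall>x\<in>W. u x = u1 x - u2 x)
      \<and> (\<forall>x\<in>W. poly_end s p u1 x = 0)
      \<and> (\<forall>x\<in>W. poly_end s q u2 x = 0)))"


definition dual :: "('a::field \<Rightarrow> 'b::ab_group_add \<Rightarrow> 'b) \<Rightarrow> ('b \<Rightarrow> 'a) set" where
  "dual s = {\<phi>. Vector_Spaces.linear s (*) \<phi>}"

definition sum_dual :: "('a::field \<Rightarrow> 'b::ab_group_add \<Rightarrow> 'b) \<Rightarrow> ('b \<times> ('b \<Rightarrow> 'a)) set" where
  "sum_dual s = UNIV \<times> dual s"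

definition scale_sum_dual ::
    "('a::field \<Rightarrow> 'b::ab_group_add \<Rightarrow> 'b) \<Rightarrow> 'a \<Rightarrow> 'b \<times> ('b \<Rightarrow> 'a) \<Rightarrow> 'b \<times> ('b \<Rightarrow> 'a)" where
  "scale_sum_dual s c = (\<lambda>(x, \<phi>). (s c x, \<lambda>y. c * \<phi> y))"

definition h_ext :: "('b \<Rightarrow> 'b) \<Rightarrow> 'b \<times> ('b \<Rightarrow> 'a) \<Rightarrow> 'b \<times> ('b \<Rightarrow> 'a)" where
  "h_ext v = (\<lambda>(x, \<phi>). (v x, \<phi> \<circ> v))"

definition S_form :: "'b \<times> ('b \<Rightarrow> 'a::field) \<Rightarrow> 'b \<times> ('b \<Rightarrow> 'a) \<Rightarrow> 'a" where
  "S_form = (\<lambda>(x, \<phi>) (y, \<psi>). \<phi> y - \<psi> x)"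

definition symplectic_extension ::
    "('b \<Rightarrow> 'b) \<Rightarrow>
       ('b \<times> ('b \<Rightarrow> 'a::field) \<Rightarrow> 'b \<times> ('b \<Rightarrow> 'a) \<Rightarrow> 'a) \<times> ('b \<times> ('b \<Rightarrow> 'a) \<Rightarrow> 'b \<times> ('b \<Rightarrow> 'a))" where
  "symplectic_extension v = (S_form, h_ext v)"

end

theory Submission
  imports Defs "HOL-Analysis.Product_Vector"
begin

text \<open>
  Put \<open>P = p(t + y1)\<close> and \<open>Q = p(t + y2)\<close>. If \<open>u = a - b\<close> with \<open>p(a) = 0 = q(b)\<close>, then
  \<open>c = b - y1\<close>, \<open>A = P(u)\<close> and \<open>B = Q(u)\<close> satisfy \<open>A c - c B = c A - B c = (y2 - y1) A\<close> and
  \<open>c\<^sup>2 = (y2 - y1) c\<close>. Hence \<open>c\<close> induces a map from the generalized kernel of \<open>A\<close> to that of \<open>B\<close>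
  which turns \<open>A\<close> into \<open>B\<close> and is injective modulo the kernel of \<open>A\<close>; comparing dimensions gives
  \<open>n\<^sub>k\<^sub>+\<^sub>1(u, P) \<le> n\<^sub>k(u, Q)\<close>. Since a map and its transpose have the same ranks, \<open>n\<^sub>k(h(v), r)\<close> is twice
  \<open>n\<^sub>k(v, r)\<close>, and the inequality for \<open>h(v)\<close> yields the one for \<open>v\<close>.

  Conversely, intertwined sequences allow one to pair the elementary divisors and to split the space
  into cyclic modules \<open>F[t]/(P\<^sup>i Q\<^sup>j)\<close> with \<open>i\<close> and \<open>j\<close> differing by at most 1. On such a module, up to
  exchanging \<open>y1\<close> and \<open>y2\<close>, one takes \<open>b f = y1 f + P (f(\<delta> - t) - f(t)) / (2t - \<delta>)\<close>, where
  \<open>\<delta>\<close> is the sum of the roots of \<open>p\<close> minus \<open>y1 + y2\<close>.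
\<close>

subsection \<open>Polynomials over a field\<close>

text \<open>Eigenvalues enter only once: they force some P^N Q^N to annihilate \<open>v\<close>. As
  P and Q are coprime, the space splits into a P-part and a Q-part. The counts n_k rest on a choice
  of decomposition, so they are replaced by dim (ker r(u) \<inter> im r(u)^k) = deg r * n_(k+1).
  This quantity is a difference of ranks, hence blind to transposition, and it doubles exactly on
  h(v). The factor 2 cancels, and (ii) gives (iv) without turning a difference on the large space
  into one on V. The origin of \<delta>: if p(a) = 0 = q(b) and t is the sum of the roots of p, the
  conjugates a* = t - a and b* = y1 + y2 - b satisfy a* - b* = \<delta> - (a - b). The reflection X
  \<mapsto> \<delta> - X is thus the natural symmetry of a difference. It exchanges P and Q, which
  is why powers of P and of Q must be paired in one cyclic module. The divided difference of this
  reflection is a polynomial in every characteristic.\<close>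

lemma irreducible_bezout:
  fixes P f :: "'a::field poly"
  assumes "irreducible P" and "\<not> P dvd f"
  obtains a b where "a * f + b * P = 1"
proof -
  define I where "I = {a * f + b * P | a b. True}"
  have f0: "f \<noteq> 0"
    using assms(2) by auto
  have fI: "f \<in> I"
    unfolding I_def by (rule CollectI, rule exI[of _ 1], rule exI[of _ 0]) simp
  have PI: "P \<in> I"
    unfolding I_def by (rule CollectI, rule exI[of _ 0], rule exI[of _ 1]) simp
  \<comment> \<open>A nonzero element of least degree divides the whole ideal spanned by
    \<open>f\<close> and \<open>P\<close>; irreducibility of \<open>P\<close> then makes it a
    unit.\<close>
  obtain h where h: "h \<in> I" "h \<noteq> 0" and hmin: "\<And>g. g \<in> I \<Longrightarrow> g \<noteq> 0 \<Longrightarrow> degree h \<le> degree g"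
    using ex_has_least_nat[of "\<lambda>g. g \<in> I \<and> g \<noteq> 0" f degree] fI f0 by blast
  have closed: "g mod h \<in> I" if "g \<in> I" for g
  proof -
    obtain a b where ab: "g = a * f + b * P"
      using \<open>g \<in> I\<close> I_def by blast
    obtain c d where cd: "h = c * f + d * P"
      using h(1) I_def by blast
    have "g mod h = (a - (g div h) * c) * f + (b - (g div h) * d) * P"
      by (simp add: minus_div_mult_eq_mod[symmetric] algebra_simps) (simp add: ab cd algebra_simps)
    then show ?thesis
      unfolding I_def by blast
  qed
  have dvd: "h dvd g" if "g \<in> I" for g
  proof (rule ccontr)
    assume "\<not> h dvd g"
    then have "g mod h \<noteq> 0"
      by (simp add: mod_eq_0_iff_dvd)
    moreover have "degree (g mod h) < degree h"
      using \<open>g mod h \<noteq> 0\<close> degree_mod_less'[OF h(2)] by blast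
    ultimately show False
      using hmin[OF closed[OF that]] by simp
  qed
  have "h dvd 1"
  proof (rule ccontr)
    assume nu: "\<not> h dvd 1"
    obtain k where k: "P = h * k"
      using dvd[OF PI] by (elim dvdE)
    then have "k dvd 1"
      using assms(1) nu irreducibleD by blast
    then obtain k' where "1 = k * k'"
      by (elim dvdE)
    then have "h = P * k'"
      using k by (simp add: mult.assoc)
    then have "P dvd f"
      using dvd[OF fI] by (metis dvd_mult_left)
    then show False
      using assms(2) by simp
  qed
  then obtain h' where h': "1 = h * h'"
    by (elim dvdE)
  obtain a b where "h = a * f + b * P"
    using h(1) unfolding I_def by blast
  then have "(h' * a) * f + (h' * b) * P = 1"
    using h' by (simp add: algebra_simps)
  then show thesis
    using that by blast
qed

text \<open>Multiplying the relation for exponent n by the given one keeps the value 1, and every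
  term except the one with \<open>P ^ Suc n\<close> contains the factor \<open>f\<close>.\<close>

lemma bezout_power:
  fixes P f :: "'a::comm_ring_1"
  assumes "a * f + b * P = 1"
  obtains c d where "c * f + d * P ^ n = 1"
proof -
  have "\<exists>c d. c * f + d * P ^ n = 1"
  proof (induction n)
    case 0
    show ?case
      by (rule exI[of _ 0], rule exI[of _ 1]) simp
  next
    case (Suc n)
    then obtain c d where cd: "c * f + d * P ^ n = 1"
      by blast
    have "(a * (c * f + d * P ^ n) + b * P * c) * f + (b * d) * P ^ Suc n
        = (a * f + b * P) * (c * f + d * P ^ n)"
      by (simp add: algebra_simps)
    then show ?case
      using assms cd by auto
  qed
  then show thesis
    using that by blast
qed

lemma irreducible_power_bezout:
  fixes P f :: "'a::field poly"
  assumes "irreducible P" and "\<not> P dvd f"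
  obtains a b where "a * f + b * P ^ n = 1"
  by (meson irreducible_bezout[OF assms] bezout_power)

lemma irreducible_dvd_imp_eq:
  fixes P Q :: "'a::field poly"
  assumes "irreducible P" "irreducible Q" "lead_coeff P = 1" "lead_coeff Q = 1" "P dvd Q"
  shows "P = Q"
proof -
  obtain k where k: "Q = P * k"
    using assms(5) by (elim dvdE)
  have "\<not> P dvd 1"
    using assms(1) irreducible_not_unit by blast
  then have "k dvd 1"
    using irreducibleD[OF assms(2) k] by blast
  then obtain c where c: "k = [:c:]"
    by (metis is_unit_polyE)
  with k have "lead_coeff Q = c * lead_coeff P"
    by (simp add: mult.commute)
  with assms c k show ?thesis
    by simp
qed

text \<open>Unique factorization and a comparison of degrees. The bound \<open>k \<ge> 1\<close>
  excludes zeroth powers, which agree for all \<open>P\<close> and \<open>Q\<close>.\<close>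

lemma irreducible_power_inject:
  fixes P Q :: "'a::field poly"
  assumes "irreducible P" "irreducible Q" "lead_coeff P = 1" "lead_coeff Q = 1"
    and "k \<ge> 1" "P ^ k = Q ^ l"
  shows "P = Q \<and> k = l"
proof -
  have d: "degree P > 0" "degree Q > 0"
    using assms(1,2) by (metis gr0I irreducible_def is_unit_iff_degree)+
  have deg: "degree (P ^ k) = k * degree P" "degree (Q ^ l) = l * degree Q"
    using assms(1,2) by (intro degree_power_eq; auto)+
  then have "l \<ge> 1"
    using assms(5,6) d by (cases l) auto
  then have "P dvd Q ^ l"
    using assms(5,6) by (metis dvd_power less_le_trans zero_less_one)
  then have "P dvd Q"
    using field_poly_irreducible_imp_prime[OF assms(1)] prime_elem_dvd_power by blast
  then have eq: "P = Q"
    by (rule irreducible_dvd_imp_eq[OF assms(1-4)])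
  have "k * degree Q = l * degree Q"
    using deg(1)[unfolded assms(6) deg(2)] eq by auto
  then have "k = l"
    using d(2) by simp
  with eq show ?thesis
    by blast
qed

lemma poly_end_degree_2:
  assumes "degree p = 2"
  shows "poly_end s p u x = s (coeff p 0) x + s (coeff p 1) (u x) + s (coeff p 2) (u (u x))"
  using assms by (simp add: poly_end_def numeral_2_eq_2 add.assoc)

subsection \<open>Dimension\<close>

context finite_dimensional_vector_space
begin

text \<open>A basis \<open>B0\<close> of the kernel in \<open>S\<close> extends to a basis
  \<open>B\<close> of \<open>S\<close>, and \<open>f\<close> maps the span of \<open>B - B0\<close>
  isomorphically onto the image. Allowing a subspace \<open>S\<close> lets the formula be applied
  inside intersections of kernels and ranges.\<close>

lemma rank_nullity:
  assumes f: "Vector_Spaces.linear scale scale f" and S: "subspace S"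
  shows "dim S = dim (f ` S) + dim {x \<in> S. f x = 0}"
proof -
  interpret f: Vector_Spaces.linear scale scale f by fact
  interpret pr: finite_dimensional_vector_space_pair_1 scale Basis scale
    by unfold_locales
  let ?K = "{x \<in> S. f x = 0}"
  have K: "subspace ?K"
    using S by (auto simp: subspace_def f.add f.scale)
  obtain B0 where B0: "B0 \<subseteq> ?K" "independent B0" "?K \<subseteq> span B0" "card B0 = dim ?K"
    using basis_exists by blast
  obtain B where B: "B0 \<subseteq> B" "B \<subseteq> S" "independent B" "S \<subseteq> span B"
    using maximal_independent_subset_extend[of B0 S] B0 by blast
  have finB: "finite B"
    using B(3) finiteI_independent by blast
  have spanB: "span B = S"
    using B S by (simp add: span_minimal subset_antisym)
  have spanB0: "span B0 = ?K"
    using B0 K by (simp add: span_minimal subset_antisym)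
  have inj: "inj_on f (span (B - B0))"
  proof (subst f.inj_on_iff_eq_0[OF subspace_span], intro ballI impI)
    fix x assume x: "x \<in> span (B - B0)" "f x = 0"
    have "x \<in> S"
      using x(1) span_mono[of "B - B0" B] spanB by blast
    then have "x \<in> span B0"
      using x(2) spanB0 by blast
    moreover have "span (B - B0) \<inter> span B0 = {0}"
    proof -
      have "dim {x + y |x y. x \<in> span (B - B0) \<and> y \<in> span B0} + dim (span (B - B0) \<inter> span B0)
          = dim (span (B - B0)) + dim (span B0)"
        by (rule dim_sums_Int) (auto)
      moreover have "{x + y |x y. x \<in> span (B - B0) \<and> y \<in> span B0} = span B"
        using B(1) span_Un[of "B - B0" B0] by (simp add: Un_absorb2)
      moreover have "dim (span (B - B0)) = card (B - B0)"
        using B(3) by (metis Diff_subset independent_mono dim_span_eq_card_independent)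
      moreover have "dim (span B0) = card B0"
        using B0(2) by (rule dim_span_eq_card_independent)
      moreover have "dim (span B) = card B"
        using B(3) by (rule dim_span_eq_card_independent)
      moreover have "card B = card (B - B0) + card B0"
        using B(1) finB by (metis card_Diff_subset card_mono finite_subset le_add_diff_inverse2)
      ultimately have "dim (span (B - B0) \<inter> span B0) = 0"
        by simp
      then show ?thesis
        using dim_eq_0[of "span (B - B0) \<inter> span B0"] span_zero by auto
    qed
    ultimately show "x = 0"
      using x(1) by blast
  qed
  have img: "f ` S = span (f ` (B - B0))"
  proof -
    have "f ` S = span (f ` B)"
      using spanB f.span_image by metis
    also have "\<dots> = span (f ` (B - B0))"
    proof (rule subset_antisym)
      have "f ` B \<subseteq> span (f ` (B - B0))"
      proof
        fix z assume "z \<in> f ` B"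
        then obtain b where b: "b \<in> B" "z = f b" by blast
        show "z \<in> span (f ` (B - B0))"
        proof (cases "b \<in> B0")
          case True
          then have "z = 0"
            using B0(1) b by blast
          then show ?thesis
            by (simp add: span_zero)
        next
          case False
          then show ?thesis
            using b by (simp add: span_base)
        qed
      qed
      then show "span (f ` B) \<subseteq> span (f ` (B - B0))"
        by (simp add: span_minimal)
    qed (intro span_mono image_mono Diff_subset)
    finally show ?thesis .
  qed
  have "dim (f ` S) = dim (B - B0)"
    using pr.dim_image_eq[OF f inj] img by simp
  also have "\<dots> = card (B - B0)"
    using B(3) by (metis Diff_subset independent_mono dim_eq_card_independent)
  finally have "dim (f ` S) = card (B - B0)" .
  moreover have "dim S = card B"
    using B(3) spanB by (metis dim_span_eq_card_independent)
  moreover have "card B = card (B - B0) + card B0"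
    using B(1) finB by (metis card_Diff_subset card_mono finite_subset le_add_diff_inverse2)
  ultimately show ?thesis
    using B0(4) by simp
qed

text \<open>Indexing by \<open>K\<close> builds injectivity into the independence hypothesis: two
  equal members would give a nontrivial relation with coefficients 1 and -1.\<close>

lemma dim_eq_card_family:
  assumes fin: "finite K" and mem: "\<And>k. k \<in> K \<Longrightarrow> g k \<in> S"
    and indep: "\<And>c. (\<Sum>k\<in>K. scale (c k) (g k)) = 0 \<Longrightarrow> \<forall>k\<in>K. c k = 0"
    and gen: "\<And>x. x \<in> S \<Longrightarrow> \<exists>c. x = (\<Sum>k\<in>K. scale (c k) (g k))"
  shows "dim S = card K"
proof -
  have inj: "inj_on g K"
  proof (rule inj_onI, rule ccontr)
    fix i j assume ij: "i \<in> K" "j \<in> K" "g i = g j" "i \<noteq> j"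
    have "(\<Sum>k\<in>K. scale ((if k = i then 1 else 0) - (if k = j then 1 else 0)) (g k))
        = (\<Sum>k\<in>K. scale (if k = i then 1 else 0) (g k)) - (\<Sum>k\<in>K. scale (if k = j then 1 else 0) (g k))"
      by (simp only: scale_left_diff_distrib sum_subtractf)
    also have "\<dots> = g i - g j"
      using ij fin by (simp add: if_distrib[of "\<lambda>c. scale c _"] cong: if_cong)
    finally have "(\<Sum>k\<in>K. scale ((if k = i then 1 else 0) - (if k = j then 1 else 0)) (g k)) = 0"
      using ij(3) by simp
    from indep[OF this] ij show False
      by auto
  qed
  have ind: "independent (g ` K)"
  proof (rule independent_if_scalars_zero)
    fix f x assume s: "(\<Sum>x\<in>g ` K. scale (f x) x) = 0" and x: "x \<in> g ` K"
    have "(\<Sum>k\<in>K. scale (f (g k)) (g k)) = 0"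
      using s inj by (simp add: sum.reindex)
    from indep[OF this] x show "f x = 0"
      by blast
  qed (use fin in simp)
  have "S \<subseteq> span (g ` K)"
  proof
    fix x assume "x \<in> S"
    then obtain c where "x = (\<Sum>k\<in>K. scale (c k) (g k))"
      using gen by blast
    then show "x \<in> span (g ` K)"
      by (simp add: span_sum span_scale span_base)
  qed
  then have "dim S = card (g ` K)"
    using mem ind by (intro dim_unique[where B = "g ` K"]) auto
  then show ?thesis
    using inj by (simp add: card_image)
qed

end

subsection \<open>The polynomial module of an endomorphism\<close>

locale lin_endo = finite_dimensional_vector_space scale Basis
  for scale :: "'a::field \<Rightarrow> 'b::ab_group_add \<Rightarrow> 'b" and Basis :: "'b set" +
  fixes u :: "'b \<Rightarrow> 'b"
  assumes linear_u: "Vector_Spaces.linear scale scale u"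
begin

sublocale u: Vector_Spaces.linear scale scale u
  by (rule linear_u)

abbreviation ev :: "'a poly \<Rightarrow> 'b \<Rightarrow> 'b" where
  "ev f \<equiv> poly_end scale f u"

lemma linear_endoI:
  "(\<And>x y. f (x + y) = f x + f y) \<Longrightarrow> (\<And>c x. f (scale c x) = scale c (f x))
    \<Longrightarrow> Vector_Spaces.linear scale scale f"
  by (simp add: Vector_Spaces.linear_iff vector_space_axioms)

lemma power_add_right: "(u ^^ n) (x + y) = (u ^^ n) x + (u ^^ n) y"
  by (induction n) (simp_all add: u.add)

lemma power_scale_right: "(u ^^ n) (scale c x) = scale c ((u ^^ n) x)"
  by (induction n) (simp_all add: u.scale)

lemma linear_ev: "Vector_Spaces.linear scale scale (ev f)"
  by (rule linear_endoI)
    (simp_all add: poly_end_def power_add_right power_scale_right scale_right_distrib sum.distrib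
      scale_sum_right mult.commute)

sublocale ev: Vector_Spaces.linear scale scale "ev f" for f
  by (rule linear_ev)

lemma ev_0_left [simp]: "ev 0 x = 0"
  by (simp add: poly_end_def)

text \<open>Horner's recursion. It replaces the sum over coefficients, whose range depends on the
  degree, so that the laws of the F[t]-module follow by induction on the polynomial.\<close>

lemma ev_pCons: "ev (pCons a f) x = scale a x + u (ev f x)"
proof (cases "f = 0")
  case True
  then show ?thesis
    by (cases "a = 0") (simp_all add: poly_end_def u.zero)
next
  case False
  then show ?thesis
    by (simp add: poly_end_def u.sum u.scale sum.atMost_Suc_shift del: sum.atMost_Suc)
qed

lemma ev_1 [simp]: "ev 1 x = x"
  by (simp add: one_pCons ev_pCons u.zero)

lemma ev_X: "ev [:0, 1:] x = u x"
  by (simp add: ev_pCons)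

lemma ev_add: "ev (f + g) x = ev f x + ev g x"
proof (induction f arbitrary: g)
  case 0
  show ?case by simp
next
  case (pCons a f)
  show ?case
    by (cases g) (simp add: ev_pCons pCons.IH u.add scale_left_distrib add.assoc add.left_commute)
qed

lemma ev_smult: "ev (smult c f) x = scale c (ev f x)"
  by (induction f) (simp_all add: ev_pCons u.scale scale_right_distrib)

lemma ev_minus: "ev (- f) x = - ev f x"
  using ev_smult[of "-1" f x] by simp

lemma ev_diff: "ev (f - g) x = ev f x - ev g x"
  using ev_add[of f "- g" x] by (simp add: ev_minus)

lemma ev_mult: "ev (f * g) x = ev f (ev g x)"
  by (induction f) (simp_all add: ev_pCons ev_add ev_smult)

lemma ev_commute: "ev f (ev g x) = ev g (ev f x)"
  by (metis ev_mult mult.commute)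

lemma ev_sum: "ev (\<Sum>i\<in>I. f i) x = (\<Sum>i\<in>I. ev (f i) x)"
  by (induction I rule: infinite_finite_induct) (simp_all add: ev_add)

lemma ev_monom: "ev (monom c i) x = scale c ((u ^^ i) x)"
  by (induction i arbitrary: c) (simp_all add: monom_0 monom_Suc ev_pCons u.scale u.zero)

lemma ev_dvd_0: "f dvd g \<Longrightarrow> ev f x = 0 \<Longrightarrow> ev g x = 0"
  by (elim dvdE) (simp add: ev_mult ev_commute[of f] ev.zero)

section \<open>Submodules and orders of vectors\<close>

definition submodule :: "'b set \<Rightarrow> bool" where
  "submodule S \<longleftrightarrow> subspace S \<and> (\<forall>x\<in>S. u x \<in> S)"

lemma submodule_ev: "submodule S \<Longrightarrow> x \<in> S \<Longrightarrow> ev f x \<in> S"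
  by (induction f) (auto simp: submodule_def ev_pCons subspace_add subspace_scale subspace_0)

lemma subspace_kernel_ev: "subspace {x. ev f x = 0}"
  by (simp add: subspace_def ev.add ev.scale)

lemma submodule_kernel_ev: "submodule {x. ev f x = 0}"
  using subspace_kernel_ev by (simp add: submodule_def) (metis ev_X ev_commute ev.zero)

text \<open>Here \<open>x\<close> has order exactly \<open>P ^ Suc n\<close>. If
  \<open>P ^ j\<close> with j \<le> n were the exact power in \<open>f\<close>, Bezout for the
  cofactor would make \<open>P ^ n\<close> a combination of \<open>f\<close> and
  \<open>P ^ Suc n\<close>, and \<open>P ^ n\<close> would kill \<open>x\<close>.\<close>

lemma order_dvd:
  assumes "irreducible P" and "ev (P ^ Suc n) x = 0" and "ev (P ^ n) x \<noteq> 0" and "ev f x = 0"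
  shows "P ^ Suc n dvd f"
proof -
  have "P ^ j dvd f" if "j \<le> Suc n" for j
    using that
  proof (induction j)
    case (Suc j)
    then obtain g where g: "f = P ^ j * g"
      by (auto elim: dvdE)
    have "P dvd g"
    proof (rule ccontr)
      assume "\<not> P dvd g"
      then obtain a b where ab: "a * g + b * P ^ Suc n = 1"
        using irreducible_power_bezout[OF assms(1)] by metis
      have "P ^ n = P ^ (n - j) * P ^ j * (a * g + b * P ^ Suc n)"
        using Suc.prems ab by (simp flip: power_add)
      also have "\<dots> = P ^ (n - j) * a * f + P ^ (n - j) * P ^ j * b * P ^ Suc n"
        by (simp add: g algebra_simps)
      finally have "ev (P ^ n) x = ev (P ^ (n - j) * a * f + P ^ (n - j) * P ^ j * b * P ^ Suc n) x"
        by simp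
      also have "\<dots> = 0"
        by (simp only: ev_add ev_mult[of _ f] ev_mult[of _ "P ^ Suc n"] assms(2,4) ev.zero add_0)
      finally show False
        using assms(3) by simp
    qed
    then show ?case
      by (simp add: g mult.commute mult_dvd_mono)
  qed simp
  from this[of "Suc n"] show ?thesis
    by blast
qed

end

subsection \<open>Primary decomposition\<close>

context lin_endo
begin

lemma dim_submodule_psubset:
  assumes "submodule T" "submodule S" "T \<subset> S"
  shows "dim T < dim S"
proof (rule dim_psubset)
  have "span T = T" "span S = S"
    using assms unfolding span_eq_iff by (simp_all add: submodule_def)
  then show "span T \<subset> span S"
    using assms(3) by metis
qed

text \<open>A submodule of maximal dimension among those meeting the cyclic module of \<open>x\<close> trivially
  is a complement, because \<open>x\<close> has maximal order.\<close>

lemma cyclic_complement: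
  assumes P: "irreducible P" and S: "submodule S" and kill: "\<And>y. y \<in> S \<Longrightarrow> ev (P ^ Suc n) y = 0"
    and x: "x \<in> S" "ev (P ^ n) x \<noteq> 0"
  obtains T where "submodule T" "T \<subseteq> S" "\<And>f. ev f x \<in> T \<Longrightarrow> ev f x = 0"
    "\<And>y. y \<in> S \<Longrightarrow> \<exists>t\<in>T. \<exists>f. y = t + ev f x"
proof -
  define Q where "Q T \<longleftrightarrow> submodule T \<and> T \<subseteq> S \<and> (\<forall>f. ev f x \<in> T \<longrightarrow> ev f x = 0)" for T
  have "Q {0}"
    using S by (auto simp: Q_def submodule_def u.zero subspace_0)
  moreover have "\<forall>T. Q T \<longrightarrow> dim T < Suc dimension"
    using dim_subset_UNIV by (simp add: less_Suc_eq_le)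
  ultimately have "\<exists>T. Q T \<and> (\<forall>T'. Q T' \<longrightarrow> dim T' \<le> dim T)"
    by (rule ex_has_greatest_nat)
  then obtain T where T: "Q T" and max: "\<And>T'. Q T' \<Longrightarrow> dim T' \<le> dim T"
    by auto
  have Tsub: "submodule T" "T \<subseteq> S" and T0: "\<And>f. ev f x \<in> T \<Longrightarrow> ev f x = 0"
    using T by (auto simp: Q_def)
  have Tadd: "a + b \<in> T" if "a \<in> T" "b \<in> T" for a b
    using that Tsub by (auto simp: submodule_def subspace_add)
  have Tneg: "- a \<in> T" if "a \<in> T" for a
    using that Tsub by (auto simp: submodule_def subspace_neg)
  have Tzero: "0 \<in> T"
    using Tsub by (auto simp: submodule_def subspace_0)
  define Z where "Z = {t + ev f x | t f. t \<in> T}"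
  have ZI: "t + ev f x \<in> Z" if "t \<in> T" for t f
    using that Z_def by blast
  have Zadd: "a + b \<in> Z" if ab: "a \<in> Z" "b \<in> Z" for a b
  proof -
    from ab obtain t f t' f' where "t \<in> T" "t' \<in> T" "a = t + ev f x" "b = t' + ev f' x"
      unfolding Z_def by blast
    then show ?thesis
      using ZI[OF Tadd, of t t' "f + f'"] by (simp add: ev_add add_ac)
  qed
  have Zev: "ev h a \<in> Z" if "a \<in> Z" for a h
  proof -
    from that obtain t f where "t \<in> T" "a = t + ev f x"
      unfolding Z_def by blast
    then show ?thesis
      using ZI[OF submodule_ev[OF Tsub(1)], of t h "h * f"] by (simp add: ev.add ev_mult)
  qed
  have TZ: "a \<in> Z" if "a \<in> T" for a
    using ZI[OF that, of 0] by simp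
  have xZ: "ev f x \<in> Z" for f
    using ZI[OF Tzero, of f] by simp
  have "y \<in> Z" if y: "y \<in> S" for y
  proof (rule ccontr)
    assume "y \<notin> Z"
    have "ev (P ^ Suc n) y \<in> Z"
      using kill[OF y] TZ[OF Tzero] by simp
    moreover have "ev (P ^ 0) y \<notin> Z"
      using \<open>y \<notin> Z\<close> by simp
    \<comment> \<open>Some step of the sequence P^j(u) y leads from outside \<open>Z\<close> into
      \<open>Z\<close>; \<open>z\<close> is the vector just before it.\<close>
    ultimately obtain j where j: "ev (P ^ j) y \<notin> Z" "ev (P ^ Suc j) y \<in> Z"
      by (metis (no_types) nat_induct[of "\<lambda>j. ev (P ^ j) y \<notin> Z" "Suc n"])
    define z where "z = ev (P ^ j) y"
    have z: "z \<notin> Z" "ev P z \<in> Z" "z \<in> S"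
      using j y submodule_ev[OF S] by (simp_all add: z_def ev_mult)
    obtain t f where tf: "t \<in> T" "ev P z = t + ev f x"
      using z(2) Z_def by blast
    have "0 = ev (P ^ n) (ev P z)"
      using kill[OF z(3)] by (simp add: ev_mult ev_commute)
    also have "\<dots> = ev (P ^ n) t + ev (P ^ n * f) x"
      by (simp add: tf ev.add ev_mult)
    finally have "ev (P ^ n * f) x = - ev (P ^ n) t"
      by (simp add: eq_neg_iff_add_eq_0 add.commute)
    then have "ev (P ^ n * f) x \<in> T"
      using Tneg submodule_ev[OF Tsub(1) tf(1)] by simp
    then have "ev (P ^ n * f) x = 0"
      by (rule T0)
    then have "P ^ Suc n dvd P ^ n * f"
      using order_dvd[OF P kill[OF x(1)] x(2)] by blast
    moreover have "P \<noteq> 0"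
      using P by auto
    ultimately have "P dvd f"
      by (simp add: mult.commute[of P])
    then obtain g where g: "f = P * g"
      by (elim dvdE)
    \<comment> \<open>The maximal order of \<open>x\<close> has made \<open>f\<close> divisible by
      \<open>P\<close>, so subtracting g(u) x corrects \<open>z\<close> to a vector outside
      \<open>Z\<close> with P(u) w in \<open>T\<close>.\<close>
    define w where "w = z - ev g x"
    have Pw: "ev P w = t"
      by (simp add: w_def ev.diff tf g ev_mult)
    have zw: "z = w + ev g x"
      by (simp add: w_def)
    have wS: "w \<in> S"
      using S z(3) submodule_ev[OF S x(1)] by (auto simp: w_def submodule_def subspace_diff)
    have wZ: "w \<notin> Z"
      using z(1) Zadd xZ zw by metis
    \<comment> \<open>Adding the cyclic module of \<open>w\<close> to \<open>T\<close> gives a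
      strictly larger competitor, against the choice of \<open>T\<close>.\<close>
    define T' where "T' = {a + ev h w | a h. a \<in> T}"
    have "Q T'"
      unfolding Q_def
    proof (intro conjI allI impI)
      show "submodule T'"
        unfolding submodule_def
      proof (intro conjI ballI subspaceI)
        show "0 \<in> T'"
          unfolding T'_def by (rule CollectI, rule exI[of _ 0], rule exI[of _ 0]) (simp add: Tzero)
      next
        fix a b assume "a \<in> T'" "b \<in> T'"
        then obtain s h s' h' where "a = s + ev h w" "b = s' + ev h' w" "s \<in> T" "s' \<in> T"
          unfolding T'_def by blast
        then have "a + b = (s + s') + ev (h + h') w" "s + s' \<in> T"
          by (simp_all add: ev_add Tadd add_ac)
        then show "a + b \<in> T'"
          unfolding T'_def by blast
      next
        fix c a assume "a \<in> T'"
        then obtain s h where "a = s + ev h w" "s \<in> T"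
          unfolding T'_def by blast
        then have "scale c a = scale c s + ev (smult c h) w" "scale c s \<in> T"
          using Tsub(1) by (simp_all add: ev_smult scale_right_distrib submodule_def subspace_scale)
        then show "scale c a \<in> T'"
          unfolding T'_def by blast
      next
        fix a assume "a \<in> T'"
        then obtain s h where "a = s + ev h w" "s \<in> T"
          unfolding T'_def by blast
        then have "u a = u s + ev ([:0, 1:] * h) w" "u s \<in> T"
          using Tsub(1) unfolding ev_mult ev_X by (simp_all add: u.add submodule_def)
        then show "u a \<in> T'"
          unfolding T'_def by blast
      qed
      show "T' \<subseteq> S"
        unfolding T'_def using S Tsub(2) submodule_ev[OF S wS]
        by (auto simp: submodule_def intro!: subspace_add)
    next
      fix e assume "ev e x \<in> T'"
      then obtain a h where ah: "a \<in> T" "ev e x = a + ev h w"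
        unfolding T'_def by blast
      \<comment> \<open>Otherwise Bezout would recover \<open>w\<close> from h(u) w and P(u) w, both
        of which lie in \<open>Z\<close>.\<close>
      have "P dvd h"
      proof (rule ccontr)
        assume "\<not> P dvd h"
        then obtain c d where "c * h + d * P = 1"
          using irreducible_bezout[OF P] by metis
        then have "w = ev (c * h + d * P) w"
          by simp
        also have "\<dots> = ev c (ev e x + - a) + ev d t"
          by (simp add: ev_add ev_mult Pw ah)
        finally show False
          using wZ Zadd Zev xZ TZ Tneg ah(1) tf(1) by metis
      qed
      then obtain h' where "h = P * h'"
        by (elim dvdE)
      then have "ev h w = ev h' t"
        by (simp add: ev_mult ev_commute[of P] Pw)
      then have "ev e x \<in> T"
        using ah Tadd submodule_ev[OF Tsub(1) tf(1)] by simp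
      then show "ev e x = 0"
        by (rule T0)
    qed
    have "T \<subseteq> T'"
    proof
      fix a assume "a \<in> T"
      then show "a \<in> T'"
        unfolding T'_def by (intro CollectI exI[of _ a] exI[of _ 0]) simp
    qed
    moreover have "w \<in> T'"
      unfolding T'_def by (intro CollectI exI[of _ 0] exI[of _ 1]) (simp add: Tzero)
    moreover have "w \<notin> T"
      using wZ TZ by blast
    ultimately have "T \<subset> T'"
      by blast
    then have "dim T < dim T'"
      using Tsub(1) \<open>Q T'\<close> dim_submodule_psubset Q_def by blast
    then show False
      using max[OF \<open>Q T'\<close>] by simp
  qed
  then show thesis
    using that[OF Tsub T0] Z_def by blast
qed

text \<open>For a submodule \<open>S\<close> this says that \<open>S\<close> is the direct sum of
  the modules F[t]/(d i). The moduli need not be prime powers, so trivial summands of modulus 1 and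
  products of coprime powers are covered.\<close>

definition cyclic_family :: "'b set \<Rightarrow> nat \<Rightarrow> (nat \<Rightarrow> 'b) \<Rightarrow> (nat \<Rightarrow> 'a poly) \<Rightarrow> bool" where
  "cyclic_family S m x d \<longleftrightarrow> (\<forall>i<m. x i \<in> S) \<and> (\<forall>y\<in>S. \<exists>f. y = (\<Sum>i<m. ev (f i) (x i)))
    \<and> (\<forall>f. (\<Sum>i<m. ev (f i) (x i)) = 0 \<longleftrightarrow> (\<forall>i<m. d i dvd f i))"

lemma cyclic_family_annihilates:
  assumes "cyclic_family S m x d" "i < m"
  shows "ev (d i) (x i) = 0"
proof -
  have "(\<Sum>j<m. ev (if j = i then d i else 0) (x j)) = 0"
    using assms by (simp add: cyclic_family_def)
  also have "(\<Sum>j<m. ev (if j = i then d i else 0) (x j)) = (\<Sum>j<m. if j = i then ev (d i) (x i) else 0)"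
    by (intro sum.cong) auto
  also have "\<dots> = ev (d i) (x i)"
    using assms(2) by simp
  finally show ?thesis .
qed

text \<open>The hypothesis \<open>order\<close> carries two facts: \<open>d0\<close> generates the
  annihilator of \<open>x0\<close>, and the cyclic module of \<open>x0\<close> meets
  \<open>T\<close> only in 0.\<close>

lemma cyclic_family_Suc:
  assumes T: "cyclic_family T m x d" "submodule T" and TS: "T \<subseteq> S" "submodule S" and x0: "x0 \<in> S" "ev d0 x0 = 0"
    and order: "\<And>f. ev f x0 \<in> T \<Longrightarrow> d0 dvd f"
    and span: "\<And>y. y \<in> S \<Longrightarrow> \<exists>t\<in>T. \<exists>f. y = t + ev f x0"
  shows "cyclic_family S (Suc m) (case_nat x0 x) (case_nat d0 d)"
  unfolding cyclic_family_def
proof (intro conjI allI ballI impI)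
  fix i assume "i < Suc m"
  then show "case_nat x0 x i \<in> S"
    using T(1) TS(1) x0 by (auto simp: cyclic_family_def split: nat.splits)
next
  fix y assume "y \<in> S"
  then obtain t f where "t \<in> T" "y = t + ev f x0"
    using span by blast
  moreover then obtain g where "t = (\<Sum>i<m. ev (g i) (x i))"
    using T(1) by (auto simp: cyclic_family_def)
  ultimately have "y = (\<Sum>i<Suc m. ev (case_nat f g i) (case_nat x0 x i))"
    unfolding sum.lessThan_Suc_shift by (simp add: add.commute)
  then show "\<exists>f. y = (\<Sum>i<Suc m. ev (f i) (case_nat x0 x i))"
    by (rule exI[of _ "case_nat f g"])
next
  fix f
  let ?t = "\<Sum>i<m. ev (f (Suc i)) (x i)"
  have "\<And>i. i < m \<Longrightarrow> ev (f (Suc i)) (x i) \<in> T"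
    using T submodule_ev by (simp add: cyclic_family_def)
  then have t: "?t \<in> T"
    using T(2) by (auto simp: submodule_def intro!: subspace_sum)
  have split: "(\<Sum>i<Suc m. ev (f i) (case_nat x0 x i)) = ev (f 0) x0 + ?t"
    unfolding sum.lessThan_Suc_shift by simp
  have "(\<Sum>i<Suc m. ev (f i) (case_nat x0 x i)) = 0 \<longleftrightarrow> d0 dvd f 0 \<and> ?t = 0"
  proof
    assume "(\<Sum>i<Suc m. ev (f i) (case_nat x0 x i)) = 0"
    then have "ev (f 0) x0 = - ?t"
      using split by (simp add: eq_neg_iff_add_eq_0)
    then have "ev (f 0) x0 \<in> T"
      using t T(2) by (simp add: submodule_def subspace_neg)
    then have "d0 dvd f 0"
      by (rule order)
    moreover then have "ev (f 0) x0 = 0"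
      using x0(2) by (rule ev_dvd_0)
    ultimately show "d0 dvd f 0 \<and> ?t = 0"
      using \<open>ev (f 0) x0 = - ?t\<close> by simp
  next
    assume "d0 dvd f 0 \<and> ?t = 0"
    then show "(\<Sum>i<Suc m. ev (f i) (case_nat x0 x i)) = 0"
      using split ev_dvd_0[OF _ x0(2)] by simp
  qed
  also have "?t = 0 \<longleftrightarrow> (\<forall>i<m. d i dvd f (Suc i))"
    using T(1)[unfolded cyclic_family_def, THEN conjunct2, THEN conjunct2, rule_format, of "\<lambda>i. f (Suc i)"] .
  also have "d0 dvd f 0 \<and> (\<forall>i<m. d i dvd f (Suc i)) \<longleftrightarrow> (\<forall>i<Suc m. case_nat d0 d i dvd f i)"
    by (auto simp: less_Suc_eq_0_disj)
  finally show "(\<Sum>i<Suc m. ev (f i) (case_nat x0 x i)) = 0 \<longleftrightarrow> (\<forall>i<Suc m. case_nat d0 d i dvd f i)" .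
qed

text \<open>Induction on the dimension: a vector of maximal order spans a direct summand, and its
  exponent bounds those of the complement, so putting it at index 0 keeps \<open>l\<close>
  non-increasing. The exponents are extended by 0 beyond \<open>m\<close>, which makes the sequences
  of two components comparable at every index.\<close>

lemma primary_submodule_decomposition:
  assumes P: "irreducible P"
  shows "submodule S \<Longrightarrow> (\<And>y. y \<in> S \<Longrightarrow> ev (P ^ n) y = 0) \<Longrightarrow>
    \<exists>m x l. cyclic_family S m x (\<lambda>i. P ^ l i) \<and> (\<forall>i. l i \<ge> 1 \<longleftrightarrow> i < m) \<and> antimono l
      \<and> (\<forall>i. l i \<le> n)"
proof (induction "dim S" arbitrary: S n rule: less_induct)
  case less
  show ?case
  proof (cases "S \<subseteq> {0}")
    case True
    then have "S = {0}"
      using less.prems(1) by (auto simp: submodule_def subspace_0)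
    then have "cyclic_family S 0 (\<lambda>_. 0) (\<lambda>_. P ^ 0)"
      by (simp add: cyclic_family_def)
    then show ?thesis
      by (intro exI[of _ 0] exI[of _ "\<lambda>_. 0::'b"] exI[of _ "\<lambda>_. 0::nat"]) (auto simp: monotone_def)
  next
    case False
    \<comment> \<open>The given \<open>n\<close> is only an upper bound; the least exponent
      \<open>N\<close> is needed to find a vector of maximal order.\<close>
    define N where "N = (LEAST N. \<forall>y\<in>S. ev (P ^ N) y = 0)"
    have n: "\<forall>y\<in>S. ev (P ^ n) y = 0"
      using less.prems(2) by blast
    have N: "\<forall>y\<in>S. ev (P ^ N) y = 0" "N \<le> n"
      unfolding N_def using n by (rule LeastI, rule Least_le)
    have "N \<noteq> 0"
      using N(1) False by auto
    then obtain k where k: "N = Suc k"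
      by (cases N) auto
    have "\<not> (\<forall>y\<in>S. ev (P ^ k) y = 0)"
      using not_less_Least[of k "\<lambda>N. \<forall>y\<in>S. ev (P ^ N) y = 0"] k by (simp add: N_def[symmetric])
    then obtain x0 where x0: "x0 \<in> S" "ev (P ^ k) x0 \<noteq> 0"
      by blast
    have kill: "\<And>y. y \<in> S \<Longrightarrow> ev (P ^ Suc k) y = 0"
      using N(1) k by blast
    obtain T where T: "submodule T" "T \<subseteq> S" "\<And>f. ev f x0 \<in> T \<Longrightarrow> ev f x0 = 0"
      "\<And>y. y \<in> S \<Longrightarrow> \<exists>t\<in>T. \<exists>f. y = t + ev f x0"
      using cyclic_complement[OF P less.prems(1) kill x0] by metis
    have "x0 \<notin> T"
      using T(3)[of 1] x0(2) by (auto simp: ev.zero)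
    then have "T \<subset> S"
      using T(2) x0(1) by blast
    then have "dim T < dim S"
      using T(1) less.prems(1) dim_submodule_psubset by blast
    moreover have "\<And>y. y \<in> T \<Longrightarrow> ev (P ^ Suc k) y = 0"
      using T(2) kill by blast
    ultimately obtain m x l where IH: "cyclic_family T m x (\<lambda>i. P ^ l i)" "\<forall>i. l i \<ge> 1 \<longleftrightarrow> i < m"
      "antimono l" "\<forall>i. l i \<le> Suc k"
      using less.hyps[OF _ T(1)] by meson
    have "cyclic_family S (Suc m) (case_nat x0 x) (case_nat (P ^ Suc k) (\<lambda>i. P ^ l i))"
      using order_dvd[OF P kill[OF x0(1)] x0(2)] T kill x0(1) less.prems(1)
      by (intro cyclic_family_Suc[OF IH(1)]) blast+
    moreover have "case_nat (P ^ Suc k) (\<lambda>i. P ^ l i) = (\<lambda>i. P ^ case_nat (Suc k) l i)"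
      by (rule ext) (simp split: nat.split)
    moreover have "\<forall>i. case_nat (Suc k) l i \<ge> 1 \<longleftrightarrow> i < Suc m"
      using IH(2) by (auto split: nat.split)
    moreover have "antimono (case_nat (Suc k) l)"
      using IH(3,4) by (auto simp: monotone_def split: nat.split)
    moreover have "\<forall>i. case_nat (Suc k) l i \<le> n"
      using IH(4) N(2) k by (auto split: nat.split intro: order_trans)
    ultimately show ?thesis
      by metis
  qed
qed

end

subsection \<open>Counting elementary divisors\<close>

text \<open>Exponents of powers of \<open>r\<close> are unique, so the multiplicity of
  \<open>r ^ k\<close> is the difference of two consecutive counts.\<close>

lemma size_filter_power_ge:
  fixes r :: "'a::field poly"
  assumes "irreducible r" "lead_coeff r = 1"
  shows "size {# d \<in># M. \<exists>l\<ge>k. d = r ^ l #} = count M (r ^ k) + size {# d \<in># M. \<exists>l\<ge>Suc k. d = r ^ l #}"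
proof (induction M)
  case (add d M)
  have "k = l" if "r ^ k = r ^ l" for l
  proof (cases "k \<ge> 1")
    case True
    then show ?thesis
      using irreducible_power_inject[OF assms(1,1,2,2) _ that] by simp
  next
    case False
    then show ?thesis
      using irreducible_power_inject[OF assms(1,1,2,2) _ that[symmetric]] by (cases "l \<ge> 1") auto
  qed
  then have "d = r ^ k \<Longrightarrow> \<not> (\<exists>l\<ge>Suc k. d = r ^ l)"
    by (metis Suc_n_not_le_n)
  moreover have "(\<exists>l\<ge>k. d = r ^ l) \<longleftrightarrow> d = r ^ k \<or> (\<exists>l\<ge>Suc k. d = r ^ l)"
    by (metis Suc_leD le_eq_less_or_eq less_eq_Suc_le order_refl)
  ultimately show ?case
    using add.IH by auto
qed simp

context lin_endo
begin

lemma is_primary_decomposition_iff_cyclic_family: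
  "is_primary_decomposition scale UNIV u xs ds \<longleftrightarrow> length xs = length ds
    \<and> (\<forall>d\<in>set ds. \<exists>r l. irreducible r \<and> lead_coeff r = 1 \<and> l \<ge> 1 \<and> d = r ^ l)
    \<and> cyclic_family UNIV (length ds) (nth xs) (nth ds)"
  by (auto simp: is_primary_decomposition_def cyclic_family_def)

text \<open>In F[t]/(r^l) the kernel of r meets the image of r^k nontrivially only if l > k, and
  then in r^(l-1) F[t]/(r^l), of dimension deg r. On summands for other irreducible polynomials r
  acts invertibly and contributes nothing. The strict inequality explains
  \<open>Suc k\<close>.\<close>

lemma dim_kernel_inter_range:
  assumes dec: "is_primary_decomposition scale UNIV u xs ds"
    and r: "irreducible r" "lead_coeff r = 1"
  shows "dim ({x. ev r x = 0} \<inter> range (ev (r ^ k)))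
    = degree r * size {# d \<in># mset ds. \<exists>l\<ge>Suc k. d = r ^ l #}"
proof -
  define n where "n = length ds"
  have cyc: "cyclic_family UNIV n (nth xs) (nth ds)"
    and prim: "\<And>i. i < n \<Longrightarrow> \<exists>r l. irreducible r \<and> lead_coeff r = 1 \<and> l \<ge> 1 \<and> ds ! i = r ^ l"
    using dec by (auto simp: is_primary_decomposition_iff_cyclic_family n_def)
  have zero_iff: "\<And>f. (\<Sum>i<n. ev (f i) (xs ! i)) = 0 \<longleftrightarrow> (\<forall>i<n. ds ! i dvd f i)"
    and gen: "\<And>y. \<exists>f. y = (\<Sum>i<n. ev (f i) (xs ! i))"
    using cyc by (simp_all add: cyclic_family_def)
  have ann: "ds ! i dvd f \<Longrightarrow> ev f (xs ! i) = 0" if "i < n" for i f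
    using cyclic_family_annihilates[OF cyc that] ev_dvd_0 by blast
  have r0: "r \<noteq> 0"
    using r(1) by auto
  define I where "I = {i. i < n \<and> (\<exists>l\<ge>Suc k. ds ! i = r ^ l)}"
  have I: "finite I" "I \<subseteq> {..<n}"
    by (auto simp: I_def)
  have size_I: "size {# d \<in># mset ds. \<exists>l\<ge>Suc k. d = r ^ l #} = card I"
    by (simp only: mset_filter[symmetric] size_mset length_filter_conv_card I_def n_def)
  have "\<forall>i\<in>I. \<exists>l. l \<ge> k \<and> ds ! i = r ^ Suc l"
    by (auto simp: I_def Suc_le_eq) (metis Suc_le_D Suc_le_mono less_eq_Suc_le power_Suc)
  then obtain e where e: "\<And>i. i \<in> I \<Longrightarrow> e i \<ge> k" "\<And>i. i \<in> I \<Longrightarrow> ds ! i = r ^ Suc (e i)"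
    by metis
  \<comment> \<open>The pair (i, j) stands for r^(e i) t^j applied to generator i; the monomials of
    degree below deg r represent a basis of F[t]/(r).\<close>
  define K where "K = I \<times> {..<degree r}"
  define g where "g = (\<lambda>(i, j). ev (r ^ e i * monom 1 j) (xs ! i))"
  have combine: "(\<Sum>ij\<in>K. scale (c ij) (g ij))
      = (\<Sum>i<n. ev (if i \<in> I then r ^ e i * (\<Sum>j<degree r. monom (c (i, j)) j) else 0) (xs ! i))"
    for c
  proof -
    have "(\<Sum>ij\<in>K. scale (c ij) (g ij)) = (\<Sum>i\<in>I. \<Sum>j<degree r. scale (c (i, j)) (g (i, j)))"
      by (simp add: K_def sum.cartesian_product)
    also have "\<dots> = (\<Sum>i\<in>I. ev (r ^ e i * (\<Sum>j<degree r. monom (c (i, j)) j)) (xs ! i))"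
    proof (rule sum.cong[OF refl])
      fix i
      have "scale (c (i, j)) (g (i, j)) = ev (r ^ e i * monom (c (i, j)) j) (xs ! i)" for j
        using smult_monom[of "c (i, j)" 1 j, symmetric] by (simp add: g_def ev_smult)
      then show "(\<Sum>j<degree r. scale (c (i, j)) (g (i, j)))
          = ev (r ^ e i * (\<Sum>j<degree r. monom (c (i, j)) j)) (xs ! i)"
        by (simp add: sum_distrib_left ev_sum)
    qed
    also have "\<dots> = (\<Sum>i<n. if i \<in> I then ev (r ^ e i * (\<Sum>j<degree r. monom (c (i, j)) j)) (xs ! i) else 0)"
      using I by (subst sum.inter_restrict[symmetric]) (auto simp: Int_absorb1)
    also have "\<dots> = (\<Sum>i<n. ev (if i \<in> I then r ^ e i * (\<Sum>j<degree r. monom (c (i, j)) j) else 0) (xs ! i))"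
      by (intro sum.cong) auto
    finally show ?thesis .
  qed
  have small: "h = 0" if "r dvd h" "\<And>j. j \<ge> degree r \<Longrightarrow> coeff h j = 0" for h
  proof (rule ccontr)
    assume "h \<noteq> 0"
    then have "degree r \<le> degree h"
      using that(1) dvd_imp_degree_le by blast
    then show False
      using that(2) \<open>h \<noteq> 0\<close> by (metis leading_coeff_0_iff)
  qed
  have coeff_sum_monom: "coeff (\<Sum>j<m. monom (c j) j) i = (if i < m then c i else 0)"
    for m i and c :: "nat \<Rightarrow> 'a"
    by (simp add: coeff_sum coeff_monom)
  have "dim ({x. ev r x = 0} \<inter> range (ev (r ^ k))) = card K"
  proof (rule dim_eq_card_family[where g = g])
    show "finite K"
      using I by (simp add: K_def)
  next
    fix ij assume "ij \<in> K"
    then obtain i j where ij: "ij = (i, j)" "i \<in> I"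
      by (auto simp: K_def)
    have "ev r (g ij) = ev (r ^ Suc (e i) * monom 1 j) (xs ! i)"
      by (simp add: g_def ij ev_mult)
    also have "\<dots> = 0"
      using ann[of i] e(2)[OF ij(2)] I ij(2) by auto
    finally have "ev r (g ij) = 0" .
    moreover have "r ^ e i = r ^ k * r ^ (e i - k)"
      using e(1)[OF ij(2)] by (simp flip: power_add)
    then have "g ij \<in> range (ev (r ^ k))"
      by (simp add: g_def ij ev_mult)
    ultimately show "g ij \<in> {x. ev r x = 0} \<inter> range (ev (r ^ k))"
      by simp
  next
    fix c assume "(\<Sum>ij\<in>K. scale (c ij) (g ij)) = 0"
    then have dvd: "\<forall>i<n. ds ! i dvd (if i \<in> I then r ^ e i * (\<Sum>j<degree r. monom (c (i, j)) j) else 0)"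
      using combine zero_iff by simp
    have "c (i, j) = 0" if "i \<in> I" "j < degree r" for i j
    proof -
      have "r ^ Suc (e i) dvd r ^ e i * (\<Sum>j<degree r. monom (c (i, j)) j)"
        using dvd[rule_format, of i] that(1) I e(2)[OF that(1)] by auto
      then have "r dvd (\<Sum>j<degree r. monom (c (i, j)) j)"
        using r0 by (simp add: mult.commute[of r])
      then have "(\<Sum>j<degree r. monom (c (i, j)) j) = 0"
        by (rule small) (simp add: coeff_sum_monom)
      moreover have "coeff (\<Sum>j<degree r. monom (c (i, j)) j) j = c (i, j)"
        using that(2) by (simp add: coeff_sum_monom)
      ultimately show ?thesis
        by simp
    qed
    then show "\<forall>ij\<in>K. c ij = 0"
      by (auto simp: K_def)
  next
    fix x assume x: "x \<in> {x. ev r x = 0} \<inter> range (ev (r ^ k))"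
    then obtain y where y: "x = ev (r ^ k) y"
      by blast
    obtain f where f: "y = (\<Sum>i<n. ev (f i) (xs ! i))"
      using gen by blast
    have xf: "x = (\<Sum>i<n. ev (r ^ k * f i) (xs ! i))"
      by (simp add: y f ev.sum ev_mult)
    have "ev r x = (\<Sum>i<n. ev (r ^ Suc k * f i) (xs ! i))"
      by (simp add: xf ev.sum ev_mult)
    then have dvd: "\<forall>i<n. ds ! i dvd r ^ Suc k * f i"
      using x zero_iff[of "\<lambda>i. r ^ Suc k * f i"] by simp
    \<comment> \<open>An index outside \<open>I\<close> carries a power of \<open>r\<close> with
      exponent at most \<open>k\<close>, or a power of another irreducible polynomial, modulo which
      \<open>r\<close> is invertible.\<close>
    have outside: "ds ! i dvd r ^ k * f i" if "i < n" "i \<notin> I" for i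
    proof -
      obtain r' l where r': "irreducible r'" "lead_coeff r' = 1" "ds ! i = r' ^ l"
        using prim \<open>i < n\<close> by blast
      show ?thesis
      proof (cases "r' = r")
        case True
        then have "l \<le> k"
          using that r'(3) by (auto simp: I_def not_less_eq_eq)
        then show ?thesis
          using r'(3) True by (simp add: le_imp_power_dvd)
      next
        case False
        have "\<not> r' dvd r ^ Suc k"
          using False irreducible_dvd_imp_eq[OF r'(1) r(1) r'(2) r(2)]
            field_poly_irreducible_imp_prime[OF r'(1)] prime_elem_dvd_power by blast
        then obtain a b where "a * r ^ Suc k + b * r' ^ l = 1"
          using irreducible_power_bezout[OF r'(1)] by metis
        then have "f i = a * (r ^ Suc k * f i) + b * r' ^ l * f i"
          by (metis mult.assoc distrib_right mult_1)
        moreover have "r' ^ l dvd a * (r ^ Suc k * f i) + b * r' ^ l * f i"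
          using dvd that(1) r'(3) by (metis dvd_add dvd_mult dvd_mult2 dvd_refl)
        ultimately have "r' ^ l dvd f i"
          by metis
        then show ?thesis
          using r'(3) by simp
      qed
    qed
    have "\<exists>c. ev (r ^ k * f i) (xs ! i) = ev (r ^ e i * (\<Sum>j<degree r. monom (c j) j)) (xs ! i)"
      if i: "i \<in> I" for i
    proof -
      have "r ^ Suc (e i) dvd r * (r ^ k * f i)"
        using dvd i I e(2)[OF i] by auto
      then have "r ^ e i dvd r ^ k * f i"
        using r0 by simp
      then obtain h where h: "r ^ k * f i = r ^ e i * h"
        by (elim dvdE)
      \<comment> \<open>Only the residue of \<open>h\<close> modulo \<open>r\<close> matters,
        because \<open>r ^ e i * r\<close> is the modulus of generator i.\<close>
      define c where "c = coeff (h mod r)"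
      have "h mod r = (\<Sum>j<degree r. monom (c j) j)"
      proof (rule poly_eqI)
        fix j
        have "coeff (h mod r) j = 0" if "\<not> j < degree r"
        proof (cases "h mod r = 0")
          case False
          then show ?thesis
            using degree_mod_less'[OF r0 False] that by (intro coeff_eq_0) simp
        qed simp
        then show "coeff (h mod r) j = coeff (\<Sum>j<degree r. monom (c j) j) j"
          by (simp add: coeff_sum_monom c_def)
      qed
      moreover have "r ^ k * f i = r ^ e i * (h mod r) + ds ! i * (h div r)"
        using arg_cong[OF mod_mult_div_eq[of h r, symmetric], of "(*) (r ^ e i)"]
        unfolding h e(2)[OF i] by (simp only: distrib_left power_Suc mult_ac)
      moreover have "ev (ds ! i * (h div r)) (xs ! i) = 0"
        using i I(2) by (intro ann dvd_triv_left) blast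
      ultimately have "ev (r ^ k * f i) (xs ! i) = ev (r ^ e i * (\<Sum>j<degree r. monom (c j) j)) (xs ! i)"
        by (simp only: ev_add add_0_right)
      then show ?thesis
        by (rule exI[of _ c])
    qed
    then obtain c where c: "\<And>i. i \<in> I \<Longrightarrow>
        ev (r ^ k * f i) (xs ! i) = ev (r ^ e i * (\<Sum>j<degree r. monom (c i j) j)) (xs ! i)"
      by metis
    have "x = (\<Sum>i<n. ev (if i \<in> I then r ^ e i * (\<Sum>j<degree r. monom (c i j) j) else 0) (xs ! i))"
      unfolding xf by (intro sum.cong) (auto simp: c ann outside)
    also have "\<dots> = (\<Sum>ij\<in>K. scale (case_prod c ij) (g ij))"
      by (simp only: combine prod.case)
    finally show "\<exists>c. x = (\<Sum>ij\<in>K. scale (c ij) (g ij))"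
      by (rule exI[of _ "case_prod c"])
  qed
  then show ?thesis
    by (simp only: size_I K_def card_cartesian_product card_lessThan mult.commute)
qed

text \<open>Multiplicities are differences of counts, and the counts are dimensions that depend on
  \<open>u\<close> alone. This gives the description in \<open>elementary_divisors\<close> its
  meaning.\<close>

lemma primary_decomposition_unique:
  assumes "is_primary_decomposition scale UNIV u xs ds"
    and "is_primary_decomposition scale UNIV u xs' ds'"
  shows "mset ds = mset ds'"
proof (rule multiset_eqI)
  fix d
  show "count (mset ds) d = count (mset ds') d"
  proof (cases "\<exists>r l. irreducible r \<and> lead_coeff r = 1 \<and> l \<ge> 1 \<and> d = r ^ l")
    case True
    then obtain r k where r: "irreducible r" "lead_coeff r = 1" and d: "d = r ^ Suc k"
      by (metis One_nat_def Suc_le_D)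
    have "degree r > 0"
      using r(1) by (metis gr0I irreducible_def is_unit_iff_degree)
    then have eq: "size {# d \<in># mset ds. \<exists>l\<ge>Suc k. d = r ^ l #} = size {# d \<in># mset ds'. \<exists>l\<ge>Suc k. d = r ^ l #}"
      for k
      using dim_kernel_inter_range[OF assms(1) r, of k] dim_kernel_inter_range[OF assms(2) r, of k]
      by simp
    show ?thesis
      using size_filter_power_ge[OF r, of "Suc k" "mset ds"] size_filter_power_ge[OF r, of "Suc k" "mset ds'"]
        eq[of k] eq[of "Suc k"] d by simp
  next
    case False
    then have "d \<notin># mset ds" "d \<notin># mset ds'"
      using False assms unfolding is_primary_decomposition_def set_mset_mset by blast+
    then show ?thesis
      by (simp only: not_in_iff)
  qed
qed

lemma n_elem_div_eq:
  assumes "is_primary_decomposition scale UNIV u xs ds"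
  shows "n_elem_div scale UNIV u r k = size {# d \<in># mset ds. \<exists>l\<ge>k. d = r ^ l #}"
proof -
  have "elementary_divisors scale UNIV u = mset ds"
    unfolding elementary_divisors_def
    using assms primary_decomposition_unique by (intro the_equality) blast+
  then show ?thesis
    by (simp add: n_elem_div_def)
qed

end

subsection \<open>Differences of two quadratic endomorphisms\<close>

lemma monic_degree_2_eq:
  fixes p :: "'a::comm_ring_1 poly"
  assumes "degree p = 2" "lead_coeff p = 1"
  shows "p = [:coeff p 0, coeff p 1, 1:]"
proof (rule poly_eqI)
  fix n :: nat
  consider "n = 0" | "n = 1" | "n = 2" | "n > 2"
    by linarith
  then show "coeff p n = coeff [:coeff p 0, coeff p 1, 1:] n"
  proof cases
    case 4
    then show ?thesis
      using assms(1) by (simp add: coeff_eq_0)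
  qed (use assms in \<open>simp_all add: numeral_2_eq_2\<close>)
qed

context finite_dimensional_vector_space
begin

text \<open>The map \<open>A\<^sup>N c\<close> intertwines \<open>A\<close> with \<open>B\<close> on the kernel of \<open>A\<^sup>N\<close>, and there its own kernel lies
  in that of \<open>A\<close>.\<close>

lemma dim_kernel_inter_range_le:
  assumes lin: "Vector_Spaces.linear scale scale A" "Vector_Spaces.linear scale scale B"
      "Vector_Spaces.linear scale scale c"
    and AB: "\<And>x. A (B x) = B (A x)"
    and Ac: "\<And>x. A (c x) = c (B x) + scale \<epsilon> (A x)"
    and cA: "\<And>x. c (A x) = B (c x) + scale \<epsilon> (A x)"
    and cc: "\<And>x. c (c x) = scale \<epsilon> (c x)"
    and \<epsilon>: "\<epsilon> \<noteq> 0"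
    and inj: "\<And>x N. (A ^^ N) x = 0 \<Longrightarrow> B x = 0 \<Longrightarrow> x = 0"
  shows "dim ({x. A x = 0} \<inter> range (A ^^ Suc k)) \<le> dim ({x. B x = 0} \<inter> range (B ^^ k))"
proof -
  interpret A: Vector_Spaces.linear scale scale A by (rule lin)
  interpret B: Vector_Spaces.linear scale scale B by (rule lin)
  interpret c: Vector_Spaces.linear scale scale c by (rule lin)
  \<comment> \<open>A vector t = A^k y of the set \<open>T\<close> below satisfies A (A t) = 0, so
    exponent k + 2 places y in \<open>V\<close>.\<close>
  define N where "N = Suc (Suc k)"
  have AN_add: "(A ^^ j) (x + y) = (A ^^ j) x + (A ^^ j) y" for j x y
    by (induction j) (simp_all add: A.add)
  have AN_scale: "(A ^^ j) (scale r x) = scale r ((A ^^ j) x)" for j x r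
    by (induction j) (simp_all add: A.scale)
  have AN_0: "(A ^^ j) 0 = 0" for j
    by (induction j) (simp_all add: A.zero)
  have ANB: "(A ^^ j) (B x) = B ((A ^^ j) x)" for j x
    by (induction j) (simp_all add: AB)
  have ANA: "(A ^^ j) (A x) = A ((A ^^ j) x)" for j x
    by (induction j) simp_all
  define V where "V = {x. (A ^^ N) x = 0}"
  have V_A: "A x \<in> V" if "x \<in> V" for x
    using that by (simp add: V_def ANA A.zero)
  have V_add: "x + y \<in> V" if "x \<in> V" "y \<in> V" for x y
    using that by (simp add: V_def AN_add)
  have V_scale: "scale r x \<in> V" if "x \<in> V" for x r
    using that by (simp add: V_def AN_scale)
  have V_B: "B x \<in> V" if "x \<in> V" for x
    using that by (simp add: V_def ANB B.zero)
  have V_inj: "x = 0" if "x \<in> V" "B x = 0" for x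
    using that inj by (simp add: V_def)
  have V_I: "x \<in> V" if "(A ^^ j) x = 0" "j \<le> N" for x j
  proof -
    have "(A ^^ N) x = (A ^^ (N - j)) ((A ^^ j) x)"
      using that(2) by (simp flip: funpow_add comp_apply[of "A ^^ _" "A ^^ _"])
    then show ?thesis
      by (simp add: V_def that(1) AN_0)
  qed
  \<comment> \<open>The next three facts show that A vanishes on each x in \<open>V\<close> with c x
    in \<open>V\<close>. If A x = 0, then \<open>cA\<close> gives B (c x) = 0, so c x = 0 because B
    is injective on \<open>V\<close>. From this \<open>step2\<close> deduces A x = 0 when A (A x) =
    0, and \<open>step3\<close> when any power of A kills x.\<close>
  have step1: "c x = 0" if "x \<in> V" "c x \<in> V" "A x = 0" for x
    using that V_inj[of "c x"] cA[of x] by (simp add: c.zero)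
  have K_A: "A x \<in> V" "c (A x) \<in> V" if "x \<in> V" "c x \<in> V" for x
    using that by (simp_all add: V_A V_B V_add V_scale cA)
  have step2: "A x = 0" if x: "x \<in> V" "c x \<in> V" and AA: "A (A x) = 0" for x
  proof -
    have "c (A x) = 0"
      using step1[OF K_A[OF x] AA] .
    then have Bcx: "B (c x) + scale \<epsilon> (A x) = 0"
      using cA by simp
    have "B (A (c x)) = A (B (c x) + scale \<epsilon> (A x))"
      by (simp add: A.add A.scale AA AB)
    then have "B (A (c x)) = 0"
      using Bcx by (simp add: A.zero)
    then have "A (c x) = 0"
      using V_inj V_A x(2) by blast
    moreover have "c (c x) \<in> V"
      using x(2) cc V_scale by simp
    ultimately have "c (c x) = 0"
      using step1 x(2) by blast
    then have "c x = 0"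
      using cc \<epsilon> by simp
    then show "A x = 0"
      using Bcx \<epsilon> by (simp add: B.zero)
  qed
  have step3: "(A ^^ Suc j) x = 0 \<longrightarrow> A x = 0" if x: "x \<in> V" "c x \<in> V" for x j
  proof (induction j)
    case (Suc j)
    have "(A ^^ j) x \<in> V \<and> c ((A ^^ j) x) \<in> V"
      by (induction j) (use x K_A in auto)
    then show ?case
      using step2[of "(A ^^ j) x"] Suc by simp
  qed simp
  \<comment> \<open>Applying \<open>A ^^ N\<close> makes c x count modulo \<open>V\<close> and, for
    x in \<open>V\<close>, annihilates the error term \<epsilon> A x.\<close>
  define C where "C x = (A ^^ N) (c x)" for x
  have C_inj: "A x = 0" if "x \<in> V" "C x = 0" for x
  proof -
    have "c x \<in> V"
      using that(2) by (simp add: C_def V_def)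
    then show ?thesis
      using step3[OF that(1), of "Suc k"] that(1) by (simp add: V_def N_def)
  qed
  have CA: "C (A x) = B (C x)" if "x \<in> V" for x
    using that by (simp add: C_def cA AN_add AN_scale ANA ANB V_def A.zero)
  have CAj: "C ((A ^^ j) x) = (B ^^ j) (C x)" if "x \<in> V" for x j
  proof (induction j)
    case (Suc j)
    have "(A ^^ j) x \<in> V"
      by (induction j) (use that V_A in auto)
    then show ?case
      using Suc CA by simp
  qed simp
  have linC: "Vector_Spaces.linear scale scale C"
    by (simp add: Vector_Spaces.linear_iff vector_space_axioms C_def c.add c.scale AN_add AN_scale)
  interpret C: Vector_Spaces.linear scale scale C by (rule linC)
  have linAj: "Vector_Spaces.linear scale scale (A ^^ j)" for j
    by (simp add: Vector_Spaces.linear_iff vector_space_axioms AN_add AN_scale)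
  have range_Aj: "subspace (range (A ^^ j))" for j
  proof -
    interpret Aj: Vector_Spaces.linear scale scale "A ^^ j"
      by (rule linAj)
    show ?thesis
      by (rule Aj.subspace_image[OF subspace_UNIV])
  qed
  define K where "K j = {x. A x = 0} \<inter> range (A ^^ j)" for j
  define Y where "Y = {x. B x = 0} \<inter> range (B ^^ k)"
  \<comment> \<open>Rank-nullity on \<open>T\<close> is used for A and for C. Together with
    rank-nullity for C on \<open>K k\<close> and \<open>K (Suc k)\<close> it gives dim K(k+1) = dim
    C(T) + dim C(K(k+1)) - dim C(K(k)) \<le> dim C(T), and C(T) lies in \<open>Y\<close>.\<close>
  define T where "T = {t \<in> range (A ^^ k). A (A t) = 0 \<and> C (A t) = 0}"
  have K_sub: "subspace (K j)" for j
    unfolding K_def using A.subspace_kernel range_Aj by (intro subspace_inter) simp_all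
  have T_sub: "subspace T"
    using range_Aj[of k] by (auto simp: T_def subspace_def A.add A.scale A.zero C.add C.scale C.zero)
  have T_V: "t \<in> V" if "t \<in> T" for t
    using that V_I[of 2 t] by (simp add: T_def N_def numeral_2_eq_2)
  have "A ` T = {x \<in> K (Suc k). C x = 0}"
  proof (intro subset_antisym subsetI)
    fix z assume "z \<in> A ` T"
    then show "z \<in> {x \<in> K (Suc k). C x = 0}"
      by (auto simp: T_def K_def)
  next
    fix z assume "z \<in> {x \<in> K (Suc k). C x = 0}"
    then obtain y where y: "z = A ((A ^^ k) y)" "A z = 0" "C z = 0"
      by (auto simp: K_def)
    then have "(A ^^ k) y \<in> T"
      by (simp add: T_def)
    then show "z \<in> A ` T"
      using y(1) by blast
  qed
  moreover have "{t \<in> T. A t = 0} = K k"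
    by (auto simp: T_def K_def A.zero C.zero)
  ultimately have d1: "dim T = dim {x \<in> K (Suc k). C x = 0} + dim (K k)"
    using rank_nullity[OF lin(1) T_sub] by simp
  have "{t \<in> T. C t = 0} = {x \<in> K k. C x = 0}"
  proof (intro subset_antisym subsetI)
    fix t assume t: "t \<in> {t \<in> T. C t = 0}"
    then have "A t = 0"
      using C_inj T_V by blast
    then show "t \<in> {x \<in> K k. C x = 0}"
      using t by (simp add: T_def K_def)
  qed (auto simp: T_def K_def A.zero C.zero)
  then have d2: "dim T = dim (C ` T) + dim {x \<in> K k. C x = 0}"
    using rank_nullity[OF linC T_sub] by simp
  have "C ` T \<subseteq> Y"
  proof
    fix z assume "z \<in> C ` T"
    then obtain t where t: "t \<in> T" "z = C t"
      by blast
    then obtain y where y: "t = (A ^^ k) y"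
      by (auto simp: T_def)
    have "(A ^^ N) y = 0"
      using t(1) y by (simp add: T_def N_def)
    then have "y \<in> V"
      by (simp add: V_def)
    then have "z = (B ^^ k) (C y)"
      using CAj t(2) y by simp
    moreover have "B z = 0"
      using CA[OF T_V[OF t(1)]] t by (simp add: T_def)
    ultimately show "z \<in> Y"
      by (simp add: Y_def)
  qed
  then have d3: "dim (C ` T) \<le> dim Y"
    by (rule dim_subset)
  have "K (Suc k) \<subseteq> K k"
    by (auto simp: K_def funpow_swap1)
  then have d4: "dim (C ` K (Suc k)) \<le> dim (C ` K k)"
    by (intro dim_subset image_mono)
  have "dim (K (Suc k)) \<le> dim Y"
    using d1 d2 d3 d4 rank_nullity[OF linC K_sub, of k] rank_nullity[OF linC K_sub, of "Suc k"]
    by linarith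
  then show ?thesis
    by (simp only: K_def Y_def)
qed

end

context lin_endo
begin

lemma ev_power_funpow: "ev (f ^ n) = ev f ^^ n"
  by (induction n) (auto simp: ev_mult)

text \<open>Since u + y = a - c with a and c quadratic, P(u) collapses to (z - y + t) c - (a c + c
  a). Likewise Q(u), with c - (z - y) for c and y, z exchanged. The relations between P(u), Q(u) and
  c are then mere expansions.\<close>

lemma difference_dim_le:
  assumes p: "p = [:n, - t, 1:]"
    and ne: "pcompose p [:y, 1:] \<noteq> pcompose p [:z, 1:]"
    and irr: "irreducible (pcompose p [:y, 1:])" "irreducible (pcompose p [:z, 1:])"
    and a: "Vector_Spaces.linear scale scale a" "\<And>x. a (a x) = scale t (a x) - scale n x"
    and b: "Vector_Spaces.linear scale scale b" "\<And>x. b (b x) = scale (y + z) (b x) - scale (y * z) x"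
    and u: "\<And>x. u x = a x - b x"
  shows "dim ({x. ev (pcompose p [:y, 1:]) x = 0} \<inter> range (ev (pcompose p [:y, 1:] ^ Suc k)))
    \<le> dim ({x. ev (pcompose p [:z, 1:]) x = 0} \<inter> range (ev (pcompose p [:z, 1:] ^ k)))"
proof -
  interpret a: Vector_Spaces.linear scale scale a by (rule a)
  interpret b: Vector_Spaces.linear scale scale b by (rule b)
  let ?P = "pcompose p [:y, 1:]" and ?Q = "pcompose p [:z, 1:]"
  define c where "c x = b x - scale y x" for x
  have monic: "pcompose p [:w, 1:] = [:w * w - t * w + n, w + w - t, 1:]" for w
    by (simp add: p pcompose_pCons algebra_simps)
  have ev: "ev (pcompose p [:w, 1:]) x
      = scale (w * w - t * w + n) x + scale (w + w - t) (u x) + u (u x)" for w x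
    by (simp add: monic ev_pCons u.add u.scale add.assoc)
  have two: "scale (w * 2) x = scale w x + scale w x" for w x
    unfolding mult_2_right by (rule scale_left_distrib)
  note expand = two a.add a.diff a.scale b.add b.diff b.scale a(2) b(2) scale_left_distrib
    scale_left_diff_distrib scale_right_distrib scale_right_diff_distrib algebra_simps
  have A: "ev ?P x = scale (z - y + t) (c x) - a (c x) - c (a x)" for x
    by (simp add: ev u c_def expand)
  have B: "ev ?Q x = scale (y - z + t) (c x - scale (z - y) x) - a (c x - scale (z - y) x)
      - (c (a x) - scale (z - y) (a x))" for x
    by (simp add: ev u c_def expand)
  have linc: "Vector_Spaces.linear scale scale c"
    by (rule linear_endoI) (simp_all add: c_def expand)
  interpret c: Vector_Spaces.linear scale scale c by (rule linc)
  have cc: "c (c x) = scale (z - y) (c x)" for x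
    by (simp add: c_def expand)
  note expand' = a.add a.diff a.scale c.add c.diff c.scale cc scale_left_distrib
    scale_left_diff_distrib scale_right_distrib scale_right_diff_distrib algebra_simps
  have "z - y \<noteq> 0"
    using ne by auto
  have inj: "x = 0" if "(ev ?P ^^ N) x = 0" "ev ?Q x = 0" for x N
  proof -
    have "\<not> ?P dvd ?Q"
      using irreducible_dvd_imp_eq[OF irr] ne by (auto simp: monic)
    then obtain f g where fg: "f * ?Q + g * ?P ^ N = 1"
      using irreducible_power_bezout[OF irr(1)] by metis
    have "x = ev (f * ?Q + g * ?P ^ N) x"
      by (simp add: fg)
    also have "\<dots> = 0"
      by (simp only: ev_add ev_mult that[folded ev_power_funpow] ev.zero add_0)
    finally show ?thesis .
  qed
  show ?thesis
    unfolding ev_power_funpow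
  proof (rule dim_kernel_inter_range_le[OF linear_ev linear_ev linc _ _ _ cc \<open>z - y \<noteq> 0\<close> inj])
    fix x
    show "ev ?P (ev ?Q x) = ev ?Q (ev ?P x)"
      by (rule ev_commute)
    show "ev ?P (c x) = c (ev ?Q x) + scale (z - y) (ev ?P x)"
      unfolding A B by (simp add: expand')
    show "c (ev ?P x) = ev ?Q (c x) + scale (z - y) (ev ?P x)"
      unfolding A B by (simp add: expand')
  qed
qed

end

section \<open>Sums over initial segments and level sets of sequences\<close>

lemma sum_lessThan_add:
  fixes g :: "nat \<Rightarrow> 'a::comm_monoid_add"
  shows "(\<Sum>i<m + n. g i) = (\<Sum>i<m. g i) + (\<Sum>i<n. g (m + i))"
  by (induction n) (simp_all add: add.assoc)

text \<open>Level sets of a non-increasing sequence are initial segments. This recovers the exponent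
  at index i from the counts n_k, as in passing to a conjugate partition.\<close>

lemma antimono_card_level_set:
  fixes l :: "nat \<Rightarrow> nat"
  assumes "antimono l" and "finite {i. l i \<ge> k}"
  shows "i < card {i. l i \<ge> k} \<longleftrightarrow> l i \<ge> k"
proof
  assume "l i \<ge> k"
  then have "{..i} \<subseteq> {i. l i \<ge> k}"
    using assms(1) by (auto simp: monotone_def intro: order_trans)
  then have "card {..i} \<le> card {i. l i \<ge> k}"
    using assms(2) by (rule card_mono[rotated])
  then show "i < card {i. l i \<ge> k}"
    by simp
next
  assume i: "i < card {i. l i \<ge> k}"
  show "l i \<ge> k"
  proof (rule ccontr)
    assume "\<not> l i \<ge> k"
    then have "{i. l i \<ge> k} \<subseteq> {..<i}"
      using assms(1) by (auto simp: monotone_def) (meson leI order_trans)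
    then have "card {i. l i \<ge> k} \<le> i"
      by (metis card_lessThan card_mono finite_lessThan)
    then show False
      using i by simp
  qed
qed

subsection \<open>A quadratic operator on polynomials\<close>

text \<open>The data are symmetric under exchanging (y, P) with (z, Q). Both instances are used: the
  order of the exponents of P and Q in a summand decides which.\<close>

locale quadratic_pair =
  fixes n t y z :: "'a::field" and P Q :: "'a poly"
  assumes P_def: "P = pcompose [:n, - t, 1:] [:y, 1:]"
    and Q_def: "Q = pcompose [:n, - t, 1:] [:z, 1:]"
    and P_neq_Q: "P \<noteq> Q"
begin

text \<open>The reflection \<open>t \<mapsto> \<delta> - t\<close> swaps \<open>P\<close> and \<open>Q\<close>. In characteristic 2 the denominator
  \<open>2t - \<delta>\<close> is a constant; it is nonzero because \<open>P \<noteq> Q\<close>.\<close>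

definition \<delta> :: 'a where "\<delta> = t - y - z"

definition reflect :: "'a poly \<Rightarrow> 'a poly" where "reflect f = pcompose f [:\<delta>, - 1:]"

definition denom :: "'a poly" where "denom = [:- \<delta>, 2:]"

text \<open>The divided difference of the reflection: it vanishes on invariant polynomials, is
  linear over them and takes invariant values.\<close>

definition quot :: "'a poly \<Rightarrow> 'a poly" where "quot f = (reflect f - f) div denom"

definition quad :: "'a poly \<Rightarrow> 'a poly" where "quad f = smult y f + P * quot f"

lemma P_eq: "P = [:y * y - t * y + n, y + y - t, 1:]"
  by (simp add: P_def pcompose_pCons algebra_simps)

lemma Q_eq: "Q = [:z * z - t * z + n, z + z - t, 1:]"
  by (simp add: Q_def pcompose_pCons algebra_simps)

lemma Q_minus_P: "Q - P = smult (z - y) denom"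
  by (simp add: P_eq Q_eq denom_def \<delta>_def algebra_simps)

lemma denom_neq_0: "denom \<noteq> 0"
  using Q_minus_P P_neq_Q by auto

lemma reflect_add: "reflect (f + g) = reflect f + reflect g"
  by (simp add: reflect_def pcompose_add)

lemma reflect_diff: "reflect (f - g) = reflect f - reflect g"
  by (simp add: reflect_def pcompose_diff)

lemma reflect_mult: "reflect (f * g) = reflect f * reflect g"
  by (simp add: reflect_def pcompose_mult)

lemma reflect_smult: "reflect (smult c f) = smult c (reflect f)"
  by (simp add: reflect_def pcompose_smult)

lemma reflect_pCons: "reflect (pCons a f) = [:a:] + [:\<delta>, - 1:] * reflect f"
  by (simp add: reflect_def pcompose_pCons)

lemma reflect_reflect: "reflect (reflect f) = f"
proof -
  have "pcompose [:\<delta>, - 1:] [:\<delta>, - 1:] = [:0, 1:]"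
    by (simp add: pcompose_pCons)
  then show ?thesis
    by (simp add: reflect_def pcompose_assoc[symmetric] pcompose_idR)
qed

lemma reflect_denom: "reflect denom = - denom"
  by (simp add: denom_def reflect_pCons) (simp add: reflect_def)

lemma reflect_P: "reflect P = Q"
  by (simp add: P_eq Q_eq reflect_pCons \<delta>_def) (simp add: reflect_def algebra_simps)

lemma reflect_Q: "reflect Q = P"
  using reflect_reflect[of P] reflect_P by simp

text \<open>Modulo \<open>denom\<close> the variable equals its reflection, so f and its reflection
  are congruent. The induction never divides by 2.\<close>

lemma denom_dvd_reflect_minus: "denom dvd reflect f - f"
proof (induction f)
  case 0
  show ?case
    by (simp add: reflect_def)
next
  case (pCons a f)
  have "reflect (pCons a f) - pCons a f = [:\<delta>, - 1:] * (reflect f - f) - denom * f"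
  proof -
    have alg: "c + s * r - (c + X' * f) = s * (r - f) - (X' - s) * f" for c s r X' :: "'a poly"
      by (simp add: algebra_simps)
    have "pCons a f = [:a:] + [:0, 1:] * f" "denom = [:0, 1:] - [:\<delta>, - 1:]"
      by (simp_all add: denom_def)
    then show ?thesis
      using reflect_pCons[of a f] alg[of "[:a:]" "[:\<delta>, - 1:]" "reflect f" "[:0, 1:]"] by metis
  qed
  then show ?case
    using dvd_diff[OF dvd_mult[OF pCons.IH] dvd_triv_left] by metis
qed

lemma denom_quot: "denom * quot f = reflect f - f"
  using denom_dvd_reflect_minus by (simp add: quot_def)

lemma quot_eqI: "denom * g = reflect f - f \<Longrightarrow> quot f = g"
  using denom_neq_0 denom_quot by (metis mult_left_cancel)

lemma quot_add: "quot (f + g) = quot f + quot g"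
  by (rule quot_eqI) (simp add: distrib_left denom_quot reflect_add)

lemma quot_diff: "quot (f - g) = quot f - quot g"
  by (rule quot_eqI) (simp add: right_diff_distrib denom_quot reflect_diff)

lemma quot_smult: "quot (smult c f) = smult c (quot f)"
  by (rule quot_eqI) (simp add: denom_quot reflect_smult smult_diff_right)

lemma quot_mult_invariant: "reflect g = g \<Longrightarrow> quot (g * f) = g * quot f"
  by (rule quot_eqI) (simp add: mult.left_commute[of denom] denom_quot reflect_mult right_diff_distrib)

lemma reflect_quot: "reflect (quot f) = quot f"
proof -
  have "reflect denom * reflect (quot f) = reflect (reflect f - f)"
    by (simp add: denom_quot flip: reflect_mult)
  then have "denom * reflect (quot f) = denom * quot f"
    by (simp add: reflect_denom reflect_diff reflect_reflect denom_quot algebra_simps)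
  then show ?thesis
    using denom_neq_0 by simp
qed

text \<open>The factor \<open>quot f\<close> is invariant, so the reflection moves only P, and Q - P
  supplies both the denominator and z - y. Hence the map f \<mapsto> P * quot f squares to z - y
  times itself, which gives \<open>quad\<close> the roots y and z.\<close>

lemma quot_P_quot: "quot (P * quot f) = smult (z - y) (quot f)"
proof (rule quot_eqI)
  have "reflect (P * quot f) - P * quot f = (Q - P) * quot f"
    by (simp add: reflect_mult reflect_P reflect_quot algebra_simps)
  then show "denom * smult (z - y) (quot f) = reflect (P * quot f) - P * quot f"
    by (simp add: Q_minus_P)
qed

text \<open>A twisted Leibniz rule: the variable passes through \<open>quot\<close> as its
  reflection, and its own divided difference is -1.\<close>

lemma quot_X: "quot ([:0, 1:] * f) = [:\<delta>, - 1:] * quot f - f"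
proof (rule quot_eqI)
  have "denom * ([:\<delta>, - 1:] * quot f - f) = [:\<delta>, - 1:] * (denom * quot f) - denom * f"
    by (simp add: algebra_simps)
  also have "\<dots> = [:\<delta>, - 1:] * reflect f - ([:\<delta>, - 1:] + denom) * f"
    unfolding denom_quot by (simp only: right_diff_distrib distrib_right diff_diff_eq)
  also have "[:\<delta>, - 1:] + denom = [:0, 1:]"
    by (simp add: denom_def)
  also have "[:\<delta>, - 1:] * reflect f = reflect ([:0, 1:] * f)"
    by (simp add: reflect_mult) (simp add: reflect_def pcompose_pCons)
  finally show "denom * ([:\<delta>, - 1:] * quot f - f) = reflect ([:0, 1:] * f) - [:0, 1:] * f" .
qed

lemma quad_diff: "quad (f - g) = quad f - quad g"
  by (simp add: quad_def quot_diff smult_diff_right algebra_simps)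

lemma quad_add: "quad (f + g) = quad f + quad g"
  by (simp add: quad_def quot_add smult_add_right algebra_simps)

lemma quad_smult: "quad (smult c f) = smult c (quad f)"
  by (simp add: quad_def quot_smult smult_add_right mult.commute)

lemma quad_quad: "quad (quad f) = smult (y + z) (quad f) - smult (y * z) f"
proof -
  have "quad (quad f) = smult y (quad f) + P * (smult y (quot f) + smult (z - y) (quot f))"
    by (simp only: quad_def[of "quad f"]) (simp add: quad_def quot_add quot_smult quot_P_quot)
  also have "smult y (quot f) + smult (z - y) (quot f) = smult z (quot f)"
    by (simp flip: smult_add_left)
  also have "P * smult z (quot f) = smult z (quad f) - smult (y * z) f"
    by (simp add: quad_def smult_add_right mult.commute)
  finally show ?thesis
    by (simp add: smult_add_left)
qed

text \<open>With X for the variable, a multiplies f by X + y and adds P * quot f, while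
  \<open>quot\<close> turns a f into (\<delta> + z - X) quot f - f. The value of \<delta> is forced
  here: (X + y) + (\<delta> + z - X) must be the scalar t. The leftover - P f reduces (X + y)^2 to t
  (X + y) - n.\<close>

lemma shift_plus_quad_twice:
  defines "a \<equiv> \<lambda>f. [:0, 1:] * f + quad f"
  shows "a (a f) = smult t (a f) - smult n f"
proof -
  have a_eq: "a f = [:y, 1:] * f + P * quot f" for f
    by (simp add: a_def quad_def algebra_simps)
  have quot_a: "quot (a f) = [:\<delta> + z, - 1:] * quot f - f"
  proof -
    have "quot (a f) = quot ([:0, 1:] * f) + smult y (quot f) + smult (z - y) (quot f)"
      by (simp only: a_def quad_def quot_add quot_smult quot_P_quot add.assoc)
    also have "\<dots> = [:\<delta>, - 1:] * quot f - f + smult z (quot f)"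
      by (simp only: quot_X add.assoc smult_add_left[symmetric]) simp
    also have "\<dots> = [:\<delta> + z, - 1:] * quot f - f"
      by (simp add: smult_add_left)
    finally show ?thesis .
  qed
  have "a (a f) = [:y, 1:] * ([:y, 1:] * f + P * quot f) + P * ([:\<delta> + z, - 1:] * quot f - f)"
    by (simp only: a_eq[of "a f"] quot_a) (simp only: a_eq)
  also have "\<dots> = ([:y, 1:] * [:y, 1:] - P) * f + P * (([:y, 1:] + [:\<delta> + z, - 1:]) * quot f)"
    by (simp only: ring_distribs mult.assoc mult.left_commute[of P]) (simp only: algebra_simps)
  also have "[:y, 1:] + [:\<delta> + z, - 1:] = [:t:]"
    by (simp add: \<delta>_def)
  also have "[:y, 1:] * [:y, 1:] - P = smult t [:y, 1:] - [:n:]"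
    by (simp add: P_eq algebra_simps)
  also have "(smult t [:y, 1:] - [:n:]) * f + P * ([:t:] * quot f) = smult t (a f) - smult n f"
    by (simp add: a_eq algebra_simps smult_add_right smult_diff_left)
  finally show ?thesis .
qed

text \<open>The invariant (P Q)^j passes through \<open>quot\<close>, and one surplus factor P is
  restored by the P in \<open>quad\<close>. So \<open>quad\<close> descends to F[t]/(P^i Q^j); a
  surplus Q calls for the exchanged instance.\<close>

lemma quad_dvd:
  assumes "i = j \<or> i = Suc j" "P ^ i * Q ^ j dvd f"
  shows "P ^ i * Q ^ j dvd quad f"
proof -
  define g where "g = (P * Q) ^ j"
  have "reflect (P * Q) = P * Q"
    by (simp add: reflect_mult reflect_P reflect_Q mult.commute)
  then have reflect_g: "reflect g = g"
    unfolding g_def by (induction j) (simp_all add: reflect_mult, simp add: reflect_def pcompose_1)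
  obtain h where h: "f = P ^ i * Q ^ j * h"
    using assms(2) by (elim dvdE)
  have "P ^ i * Q ^ j dvd P * quot f"
    using assms(1)
  proof
    assume "i = j"
    then show ?thesis
      using h quot_mult_invariant[OF reflect_g, of h] by (simp add: g_def power_mult_distrib mult.left_commute)
  next
    assume "i = Suc j"
    then have "f = g * (P * h)"
      using h by (simp add: g_def power_mult_distrib mult_ac)
    then have "P * quot f = P ^ i * Q ^ j * quot (P * h)"
      using quot_mult_invariant[OF reflect_g, of "P * h"] \<open>i = Suc j\<close>
      by (simp add: g_def power_mult_distrib mult_ac)
    then show ?thesis
      by simp
  qed
  then show ?thesis
    using assms(2) by (simp add: quad_def dvd_smult)
qed

end

subsection \<open>Cyclic families\<close>

context lin_endo
begin

text \<open>The operator acts on arbitrarily chosen representatives; preservation of the ideals (e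
  i) makes the result independent of the choice.\<close>

lemma operator_from_cyclic_family:
  assumes cyc: "cyclic_family UNIV m x e"
    and diff: "\<And>i f g. \<beta> i (f - g) = \<beta> i f - \<beta> i g" and add: "\<And>i f g. \<beta> i (f + g) = \<beta> i f + \<beta> i g"
    and smult: "\<And>i c f. \<beta> i (smult c f) = smult c (\<beta> i f)"
    and dvd: "\<And>i f. i < m \<Longrightarrow> e i dvd f \<Longrightarrow> e i dvd \<beta> i f"
  obtains b where "Vector_Spaces.linear scale scale b"
    and "\<And>f. b (\<Sum>i<m. ev (f i) (x i)) = (\<Sum>i<m. ev (\<beta> i (f i)) (x i))"
proof -
  have gen: "\<forall>y. \<exists>f. y = (\<Sum>i<m. ev (f i) (x i))"
    and zero_iff: "\<And>f. (\<Sum>i<m. ev (f i) (x i)) = 0 \<longleftrightarrow> (\<forall>i<m. e i dvd f i)"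
    using cyc by (simp_all add: cyclic_family_def)
  obtain F where F: "\<And>y. y = (\<Sum>i<m. ev (F y i) (x i))"
    using gen by metis
  define b where "b y = (\<Sum>i<m. ev (\<beta> i (F y i)) (x i))" for y
  have b: "b (\<Sum>i<m. ev (f i) (x i)) = (\<Sum>i<m. ev (\<beta> i (f i)) (x i))" for f
  proof -
    define y where "y = (\<Sum>i<m. ev (f i) (x i))"
    have "(\<Sum>i<m. ev (F y i - f i) (x i)) = 0"
      using F[of y] by (simp add: ev_diff sum_subtractf y_def)
    then have "\<forall>i<m. e i dvd \<beta> i (F y i - f i)"
      using zero_iff[of "\<lambda>i. F y i - f i"] dvd by simp
    then have "(\<Sum>i<m. ev (\<beta> i (F y i - f i)) (x i)) = 0"
      using zero_iff[of "\<lambda>i. \<beta> i (F y i - f i)"] by simp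
    then show ?thesis
      by (simp add: diff ev_diff sum_subtractf b_def y_def)
  qed
  have "Vector_Spaces.linear scale scale b"
  proof (rule linear_endoI)
    fix v w
    have "v + w = (\<Sum>i<m. ev (F v i + F w i) (x i))"
      by (simp only: ev_add sum.distrib flip: F)
    then have "b (v + w) = (\<Sum>i<m. ev (\<beta> i (F v i + F w i)) (x i))"
      by (simp only: b)
    then show "b (v + w) = b v + b w"
      by (simp only: add ev_add sum.distrib b_def)
  next
    fix c v
    have "scale c v = (\<Sum>i<m. ev (smult c (F v i)) (x i))"
      by (simp only: ev_smult flip: F scale_sum_right)
    then have "b (scale c v) = (\<Sum>i<m. ev (\<beta> i (smult c (F v i))) (x i))"
      by (simp only: b)
    then show "b (scale c v) = scale c (b v)"
      by (simp only: smult ev_smult scale_sum_right b_def)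
  qed
  then show thesis
    using that b by blast
qed

text \<open>Adds zero summands F[t]/(1), generated by 0, so that two families can be given the same
  length.\<close>

lemma cyclic_family_pad:
  assumes "cyclic_family S m x d" "m \<le> M" "\<And>i. m \<le> i \<Longrightarrow> d i = 1" "0 \<in> S"
  shows "cyclic_family S M (\<lambda>i. if i < m then x i else 0) d"
proof -
  have "(\<Sum>i<M. ev (f i) (if i < m then x i else 0)) = (\<Sum>i<m. ev (f i) (x i))" for f
    using sum_lessThan_add[of "\<lambda>i. ev (f i) (if i < m then x i else 0)" m "M - m"] assms(2)
    by (simp add: ev.zero)
  moreover have "(\<forall>i<M. d i dvd f i) \<longleftrightarrow> (\<forall>i<m. d i dvd f i)" for f
    using assms(2,3) by (metis less_le_trans not_le one_dvd)
  ultimately show ?thesis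
    using assms(1,4) by (auto simp: cyclic_family_def)
qed

lemma independent_sum_eq_0:
  assumes "submodule V" "submodule W" "V \<inter> W = {0}" "a \<in> V" "b \<in> W"
  shows "a + b = 0 \<longleftrightarrow> a = 0 \<and> b = 0"
proof
  assume "a + b = 0"
  then have "a = - b"
    by (simp add: eq_neg_iff_add_eq_0)
  then have "a \<in> W"
    using assms(2,5) by (simp add: submodule_def subspace_neg)
  then have "a = 0"
    using assms(3,4) by blast
  then show "a = 0 \<and> b = 0"
    using \<open>a = - b\<close> by simp
qed simp

lemma cyclic_family_sum_mem:
  assumes "cyclic_family S m x d" "submodule S"
  shows "(\<Sum>i<m. ev (f i) (x i)) \<in> S"
proof -
  have "\<And>i. i < m \<Longrightarrow> ev (f i) (x i) \<in> S"
    using assms submodule_ev by (simp add: cyclic_family_def)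
  then show ?thesis
    using assms(2) by (auto simp: submodule_def intro!: subspace_sum)
qed

lemma cyclic_family_append:
  assumes V: "cyclic_family V m x d" "submodule V" and W: "cyclic_family W n y e" "submodule W"
    and sum: "V \<inter> W = {0}" "\<And>s. \<exists>a\<in>V. \<exists>b\<in>W. s = a + b"
  shows "cyclic_family UNIV (m + n) (\<lambda>i. if i < m then x i else y (i - m)) (\<lambda>i. if i < m then d i else e (i - m))"
    (is "cyclic_family UNIV _ ?x ?d")
  unfolding cyclic_family_def
proof (intro conjI allI ballI impI)
  have split: "(\<Sum>i<m + n. ev (f i) (?x i)) = (\<Sum>i<m. ev (f i) (x i)) + (\<Sum>i<n. ev (f (m + i)) (y i))" for f
    by (simp add: sum_lessThan_add)
  fix s
  obtain a b where ab: "a \<in> V" "b \<in> W" "s = a + b"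
    using sum(2) by blast
  then obtain f g where "a = (\<Sum>i<m. ev (f i) (x i))" "b = (\<Sum>i<n. ev (g i) (y i))"
    using V(1) W(1) unfolding cyclic_family_def by metis
  then have "s = (\<Sum>i<m + n. ev ((if i < m then f i else g (i - m))) (?x i))"
    by (simp add: split ab(3))
  then show "\<exists>f. s = (\<Sum>i<m + n. ev (f i) (?x i))"
    by (rule exI[of _ "\<lambda>i. if i < m then f i else g (i - m)"])
next
  have split: "(\<Sum>i<m + n. ev (f i) (?x i)) = (\<Sum>i<m. ev (f i) (x i)) + (\<Sum>i<n. ev (f (m + i)) (y i))" for f
    by (simp add: sum_lessThan_add)
  fix f
  have "(\<Sum>i<m + n. ev (f i) (?x i)) = 0
      \<longleftrightarrow> (\<Sum>i<m. ev (f i) (x i)) = 0 \<and> (\<Sum>i<n. ev (f (m + i)) (y i)) = 0"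
    unfolding split
    by (rule independent_sum_eq_0[OF V(2) W(2) sum(1)])
      (rule cyclic_family_sum_mem[OF V] cyclic_family_sum_mem[OF W])+
  also have "\<dots> \<longleftrightarrow> (\<forall>i<m. d i dvd f i) \<and> (\<forall>i<n. e i dvd f (m + i))"
    using V(1) W(1)[unfolded cyclic_family_def, THEN conjunct2, THEN conjunct2, rule_format, of "\<lambda>i. f (m + i)"]
    by (simp add: cyclic_family_def)
  also have "\<dots> \<longleftrightarrow> (\<forall>i<m + n. ?d i dvd f i)"
  proof (intro iffI allI impI)
    fix i assume H: "(\<forall>i<m. d i dvd f i) \<and> (\<forall>i<n. e i dvd f (m + i))" and i: "i < m + n"
    show "?d i dvd f i"
    proof (cases "i < m")
      case False
      then have "e (i - m) dvd f (m + (i - m))"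
        using H i by (metis add_diff_inverse_nat nat_add_left_cancel_less)
      then show ?thesis
        using False by simp
    qed (use H in simp)
  next
    assume H: "\<forall>i<m + n. ?d i dvd f i"
    have "d i dvd f i" if "i < m" for i
      using H[rule_format, of i] that by simp
    moreover have "e i dvd f (m + i)" if "i < n" for i
      using H[rule_format, of "m + i"] that by simp
    ultimately show "(\<forall>i<m. d i dvd f i) \<and> (\<forall>i<n. e i dvd f (m + i))"
      by blast
  qed
  finally show "(\<Sum>i<m + n. ev (f i) (?x i)) = 0 \<longleftrightarrow> (\<forall>i<m + n. ?d i dvd f i)" .
qed simp_all

text \<open>Chinese remainder theorem: for coprime moduli the sum of the two i-th generators
  generates the sum of their cyclic modules.\<close>

lemma cyclic_family_merge:
  assumes V: "cyclic_family V m x d" "submodule V" and W: "cyclic_family W m y e" "submodule W"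
    and sum: "V \<inter> W = {0}" "\<And>s. \<exists>a\<in>V. \<exists>b\<in>W. s = a + b"
    and coprime: "\<And>i. \<exists>a b. a * d i + b * e i = 1"
  shows "cyclic_family UNIV m (\<lambda>i. x i + y i) (\<lambda>i. d i * e i)"
  unfolding cyclic_family_def
proof (intro conjI allI ballI impI)
  obtain a b where ab: "\<And>i. a i * d i + b i * e i = 1"
    using coprime by metis
  fix s
  obtain v w where vw: "v \<in> V" "w \<in> W" "s = v + w"
    using sum(2) by blast
  then obtain f g where fg: "v = (\<Sum>i<m. ev (f i) (x i))" "w = (\<Sum>i<m. ev (g i) (y i))"
    using V(1) W(1) unfolding cyclic_family_def by metis
  \<comment> \<open>The Chinese remainder solution: \<open>h i\<close> is congruent to
    \<open>f i\<close> modulo \<open>d i\<close> and to \<open>g i\<close> modulo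
    \<open>e i\<close>.\<close>
  define h where "h i = f i * (b i * e i) + g i * (a i * d i)" for i
  have "ev (h i) (x i) = ev (f i) (x i)" if "i < m" for i
  proof -
    have "h i = f i * (a i * d i + b i * e i) + (g i - f i) * a i * d i"
      by (simp add: h_def algebra_simps)
    then have "h i = f i + (g i - f i) * a i * d i"
      by (simp add: ab)
    then show ?thesis
      using cyclic_family_annihilates[OF V(1) that] by (simp add: ev_add ev_mult[of _ "d i"] ev.zero)
  qed
  moreover have "ev (h i) (y i) = ev (g i) (y i)" if "i < m" for i
  proof -
    have "h i = g i * (a i * d i + b i * e i) + (f i - g i) * b i * e i"
      by (simp add: h_def algebra_simps)
    then have "h i = g i + (f i - g i) * b i * e i"
      by (simp add: ab)
    then show ?thesis
      using cyclic_family_annihilates[OF W(1) that] by (simp add: ev_add ev_mult[of _ "e i"] ev.zero)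
  qed
  ultimately have "s = (\<Sum>i<m. ev (h i) (x i + y i))"
    by (simp add: vw(3) fg ev.add sum.distrib)
  then show "\<exists>f. s = (\<Sum>i<m. ev (f i) (x i + y i))"
    by (rule exI[of _ h])
next
  fix f
  have "(\<Sum>i<m. ev (f i) (x i + y i)) = (\<Sum>i<m. ev (f i) (x i)) + (\<Sum>i<m. ev (f i) (y i))"
    by (simp add: ev.add sum.distrib)
  then have "(\<Sum>i<m. ev (f i) (x i + y i)) = 0
      \<longleftrightarrow> (\<Sum>i<m. ev (f i) (x i)) = 0 \<and> (\<Sum>i<m. ev (f i) (y i)) = 0"
    using independent_sum_eq_0[OF V(2) W(2) sum(1) cyclic_family_sum_mem[OF V] cyclic_family_sum_mem[OF W]]
    by simp
  also have "\<dots> \<longleftrightarrow> (\<forall>i<m. d i dvd f i \<and> e i dvd f i)"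
    using V(1) W(1) by (auto simp: cyclic_family_def)
  also have "\<dots> \<longleftrightarrow> (\<forall>i<m. d i * e i dvd f i)"
  proof -
    have "d i * e i dvd h" if "d i dvd h" "e i dvd h" for i h
    proof -
      obtain a b where "a * d i + b * e i = 1"
        using coprime by metis
      then have "h = h * (a * d i + b * e i)"
        by simp
      also have "\<dots> = a * (d i * h) + b * (h * e i)"
        by (simp add: algebra_simps)
      also have "d i * e i dvd \<dots>"
        using that by (intro dvd_add dvd_mult mult_dvd_mono) simp_all
      finally show ?thesis .
    qed
    then show ?thesis
      by (meson dvd_mult_left dvd_mult_right)
  qed
  finally show "(\<Sum>i<m. ev (f i) (x i + y i)) = 0 \<longleftrightarrow> (\<forall>i<m. d i * e i dvd f i)" .
qed simp_all

end

subsection \<open>Exceptional endomorphisms\<close>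

lemma exists_irreducible_factor:
  fixes f :: "'a::field poly"
  assumes "degree f > 0"
  obtains r where "irreducible r" "r dvd f"
proof -
  obtain r where r: "r dvd f" "degree r > 0"
    and least: "\<And>g. g dvd f \<Longrightarrow> degree g > 0 \<Longrightarrow> degree r \<le> degree g"
    using ex_has_least_nat[of "\<lambda>g. g dvd f \<and> degree g > 0" f degree] assms by auto
  have "irreducible r"
  proof (rule irreducibleI)
    show "r \<noteq> 0"
      using r(2) by auto
    show "\<not> r dvd 1"
      using r(2) by (simp add: is_unit_iff_degree \<open>r \<noteq> 0\<close>)
    fix a b assume ab: "r = a * b"
    have ab0: "a \<noteq> 0" "b \<noteq> 0"
      using ab \<open>r \<noteq> 0\<close> by auto
    show "a dvd 1 \<or> b dvd 1"
    proof (rule ccontr)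
      assume "\<not> (a dvd 1 \<or> b dvd 1)"
      then have "degree a > 0" "degree b > 0"
        using ab0 by (auto simp: is_unit_iff_degree)
      moreover have "a dvd f"
        using ab r(1) by (metis dvd_mult_left)
      ultimately show False
        using least[of a] ab ab0 by (simp add: degree_mult_eq)
    qed
  qed
  then show thesis
    using r(1) that by blast
qed

text \<open>Counted with multiplicity, \<open>f\<close> has at most \<open>degree f\<close>
  irreducible factors, and each can be charged to one factor \<open>g\<close>.\<close>

lemma dvd_power_if_irreducible_factors_dvd:
  fixes f g :: "'a::field poly"
  shows "f \<noteq> 0 \<Longrightarrow> (\<And>r. irreducible r \<Longrightarrow> r dvd f \<Longrightarrow> r dvd g) \<Longrightarrow> f dvd g ^ degree f"
proof (induction "degree f" arbitrary: f rule: less_induct)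
  case less
  show ?case
  proof (cases "degree f = 0")
    case True
    then show ?thesis
      using less.prems(1) is_unit_iff_degree by auto
  next
    case False
    then obtain r where r: "irreducible r" "r dvd f"
      using exists_irreducible_factor by blast
    then obtain h where h: "f = r * h"
      by (elim dvdE)
    have nz: "r \<noteq> 0" "h \<noteq> 0"
      using h less.prems(1) by auto
    have "degree r > 0"
      using r(1) by (metis gr0I irreducible_def is_unit_iff_degree)
    then have lt: "degree h < degree f"
      using h nz by (simp add: degree_mult_eq)
    then have "h dvd g ^ degree h"
      using less.hyps[OF lt nz(2)] less.prems(2) h by (metis dvd_mult)
    then have "f dvd g ^ Suc (degree h)"
      unfolding h power_Suc using less.prems(2)[OF r] by (intro mult_dvd_mono)
    also have "\<dots> dvd g ^ degree f"
      using lt by (intro le_imp_power_dvd) simp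
    finally show ?thesis .
  qed
qed

lemma irreducible_common_root_dvd:
  fixes r f :: "'a::field poly"
  assumes "irreducible r" "poly (map_poly to_ac r) x = 0" "poly (map_poly to_ac f) x = 0"
  shows "r dvd f"
proof (rule ccontr)
  have hom: "map_poly to_ac (g * h) = map_poly to_ac g * map_poly to_ac h"
    "map_poly to_ac (g + h) = map_poly to_ac g + map_poly to_ac h" for g h :: "'a poly"
    by (intro poly_eqI; simp add: coeff_map_poly coeff_mult to_ac_sum)+
  assume "\<not> r dvd f"
  then obtain a b where "a * f + b * r = 1"
    using irreducible_bezout[OF assms(1)] by metis
  then have "poly (map_poly to_ac (a * f + b * r)) x = 1"
    by (simp add: map_poly_1')
  then show False
    using assms(2,3) by (simp add: hom)
qed

context lin_endo
begin

lemma exists_annihilator: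
  obtains f where "f \<noteq> 0" "\<And>x. ev f x = 0"
proof -
  have local_annihilator: "\<exists>f. f \<noteq> 0 \<and> ev f x = 0" for x
  proof (rule ccontr)
    assume neg: "\<nexists>f. f \<noteq> 0 \<and> ev f x = 0"
    \<comment> \<open>This index set has \<open>dimension + 1\<close> elements, one too many for the
      iterates of \<open>u\<close> at \<open>x\<close> to be independent.\<close>
    define K where "K = {..dimension}"
    have sum: "(\<Sum>i\<in>K. scale (c i) ((u ^^ i) x)) = ev (\<Sum>i\<in>K. monom (c i) i) x" for c
      by (simp add: ev_sum ev_monom)
    have "dim {\<Sum>i\<in>K. scale (c i) ((u ^^ i) x) | c. True} = card K"
    proof (rule dim_eq_card_family[where g = "\<lambda>i. (u ^^ i) x"])
      fix k assume k: "k \<in> K"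
      have "(\<Sum>i\<in>K. scale (if i = k then 1 else 0) ((u ^^ i) x)) = (\<Sum>i\<in>K. if i = k then (u ^^ i) x else 0)"
        by (intro sum.cong) auto
      then have "(u ^^ k) x = (\<Sum>i\<in>K. scale (if i = k then 1 else 0) ((u ^^ i) x))"
        using k by (simp add: K_def)
      then show "(u ^^ k) x \<in> {\<Sum>i\<in>K. scale (c i) ((u ^^ i) x) | c. True}"
        by (intro CollectI exI[of _ "\<lambda>i. if i = k then 1 else 0"]) simp
    next
      fix c assume "(\<Sum>i\<in>K. scale (c i) ((u ^^ i) x)) = 0"
      then have *: "(\<Sum>i\<in>K. monom (c i) i) = 0"
        using neg sum by auto
      show "\<forall>k\<in>K. c k = 0"
      proof
        fix k assume "k \<in> K"
        have "coeff (\<Sum>i\<in>K. monom (c i) i) k = (if k \<in> K then c k else 0)"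
          by (simp add: coeff_sum coeff_monom K_def)
        then show "c k = 0"
          using * \<open>k \<in> K\<close> by simp
      qed
    qed (auto simp: K_def)
    then show False
      using dim_subset_UNIV[of "{\<Sum>i\<in>K. scale (c i) ((u ^^ i) x) | c. True}"] by (simp add: K_def)
  qed
  have "\<exists>f. f \<noteq> 0 \<and> (\<forall>x\<in>B. ev f x = 0)" if "finite B" for B
    using that
  proof induction
    case (insert x B)
    then obtain f g where "f \<noteq> 0" "\<forall>x\<in>B. ev f x = 0" "g \<noteq> 0" "ev g x = 0"
      using local_annihilator by metis
    then have "ev (f * g) v = 0" if "v \<in> insert x B" for v
      using that ev_commute[of f g v] by (auto simp: ev_mult ev.zero)
    then show ?case
      using \<open>f \<noteq> 0\<close> \<open>g \<noteq> 0\<close> by (intro exI[of _ "f * g"]) simp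
  qed (intro exI[of _ 1], simp)
  then obtain f where f: "f \<noteq> 0" "\<forall>x\<in>Basis. ev f x = 0"
    using finite_Basis by blast
  have "span Basis \<subseteq> {x. ev f x = 0}"
    using f(2) by (intro span_minimal subspace_kernel_ev) auto
  then show thesis
    using that[OF f(1)] span_Basis by auto
qed

text \<open>With \<open>r = (t - z) g\<close> over the algebraic closure, \<open>g(u) x\<close> is an eigenvector.\<close>

lemma root_imp_eigenvalue:
  assumes r: "irreducible r" and x: "x \<noteq> 0" "ev r x = 0" and z: "poly (map_poly to_ac r) z = 0"
  shows "z \<in> eigenvalues_ac scale Basis u"
proof -
  define R where "R = representation Basis"
  define r' where "r' = map_poly to_ac r"
  obtain g where g: "r' = [:- z, 1:] * g"
    using z by (auto simp: r'_def poly_eq_0_iff_dvd elim: dvdE)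
  have "r' \<noteq> 0"
    using r by (auto simp: r'_def map_poly_eq_0_iff)
  then have "g \<noteq> 0"
    using g by auto
  define d where "d = degree g"
  have "degree r' = degree r"
    by (simp add: r'_def degree_map_poly)
  moreover have "degree r' = Suc d"
    using \<open>g \<noteq> 0\<close> unfolding g d_def by (subst degree_mult_eq) auto
  ultimately have deg: "degree r = Suc d"
    by simp
  have R_sum: "(\<Sum>k\<in>Basis. scale (R v k) k) = v" for v
    unfolding R_def using finite_Basis
    by (intro sum_representation_eq independent_Basis) (auto simp: span_Basis)
  have R_add: "R (v + w) i = R v i + R w i" for v w i
    by (simp add: R_def representation_add independent_Basis span_Basis)
  have R_scale: "R (scale c v) i = c * R v i" for c v i
    by (simp add: R_def representation_scale independent_Basis span_Basis)
  have R_0: "R 0 i = 0" for i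
    using R_scale[of 0 0 i] by simp
  have R_setsum: "R (\<Sum>a\<in>A. h a) i = (\<Sum>a\<in>A. R (h a) i)" for A :: "nat set" and h i
    by (simp add: R_def representation_sum independent_Basis span_Basis)
  have R_setsum': "R (\<Sum>a\<in>A. h a) i = (\<Sum>a\<in>A. R (h a) i)" for A :: "'b set" and h i
    by (simp add: R_def representation_sum independent_Basis span_Basis)
  have R_u: "R (u v) i = (\<Sum>k\<in>Basis. R (u k) i * R v k)" for v i
  proof -
    have "R (u v) i = R (u (\<Sum>k\<in>Basis. scale (R v k) k)) i"
      by (simp only: R_sum)
    also have "\<dots> = (\<Sum>k\<in>Basis. R (u k) i * R v k)"
      by (simp only: u.sum u.scale R_setsum' R_scale mult.commute)
    finally show ?thesis .
  qed
  \<comment> \<open>The coordinates of g(u) x over the algebraic closure.\<close>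
  define c where "c i = (\<Sum>j\<le>d. coeff g j * to_ac (R ((u ^^ j) x) i))" for i
  have "(\<Sum>k\<in>Basis. to_ac (R (u k) i) * c k) = z * c i" for i
  proof -
    define E where "E j = to_ac (R ((u ^^ j) x) i)" for j
    have "(\<Sum>k\<in>Basis. to_ac (R (u k) i) * c k)
        = (\<Sum>k\<in>Basis. \<Sum>j\<le>d. coeff g j * (to_ac (R (u k) i) * to_ac (R ((u ^^ j) x) k)))"
      by (simp add: c_def sum_distrib_left mult.left_commute)
    also have "\<dots> = (\<Sum>j\<le>d. coeff g j * (\<Sum>k\<in>Basis. to_ac (R (u k) i) * to_ac (R ((u ^^ j) x) k)))"
      unfolding sum_distrib_left by (rule sum.swap)
    also have "\<dots> = (\<Sum>j\<le>d. coeff g j * E (Suc j))"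
    proof (intro sum.cong refl arg_cong2[of _ _ _ _ "(*)"])
      fix j
      show "(\<Sum>k\<in>Basis. to_ac (R (u k) i) * to_ac (R ((u ^^ j) x) k)) = E (Suc j)"
        using R_u[of "(u ^^ j) x" i] by (simp only: E_def to_ac_sum to_ac_mult funpow.simps comp_def)
    qed
    finally have left: "(\<Sum>k\<in>Basis. to_ac (R (u k) i) * c k) = (\<Sum>j\<le>d. coeff g j * E (Suc j))" .
    have "0 = to_ac (R (ev r x) i)"
      by (simp add: x(2) R_0)
    also have "\<dots> = (\<Sum>j\<le>Suc d. coeff r' j * E j)"
      by (simp add: poly_end_def deg R_setsum R_scale to_ac_sum r'_def coeff_map_poly E_def
          del: sum.atMost_Suc funpow.simps)
    \<comment> \<open>The factor t - z of r' splits the vanishing of r(u) x into the shifted sum, on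
      which u has acted once, and z times the original sum.\<close>
    also have "\<dots> = (\<Sum>j\<le>Suc d. coeff (pCons 0 g) j * E j) - (\<Sum>j\<le>Suc d. z * coeff g j * E j)"
      by (simp add: g sum_subtractf[symmetric] algebra_simps del: sum.atMost_Suc)
    also have "(\<Sum>j\<le>Suc d. coeff (pCons 0 g) j * E j) = (\<Sum>j\<le>d. coeff g j * E (Suc j))"
      by (simp add: sum.atMost_Suc_shift del: sum.atMost_Suc)
    also have "(\<Sum>j\<le>Suc d. z * coeff g j * E j) = z * c i"
      by (simp add: coeff_eq_0 d_def c_def E_def sum_distrib_left mult.assoc)
    finally show ?thesis
      using left by simp
  qed
  moreover have "\<exists>i\<in>Basis. c i \<noteq> 0"
  proof (rule ccontr)
    assume "\<not> (\<exists>i\<in>Basis. c i \<noteq> 0)"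
    then have c0: "\<And>i. i \<in> Basis \<Longrightarrow> c i = 0"
      by blast
    interpret vp: vector_space_pair scale "(*) :: 'a \<Rightarrow> 'a \<Rightarrow> 'a"
      by unfold_locales (simp_all add: algebra_simps)
    let ?v = "\<lambda>j. (u ^^ j) x"
    have sum: "(\<Sum>j\<le>d. scale (c j) (?v j)) = ev (\<Sum>j\<le>d. monom (c j) j) x" for c
      by (simp add: ev_sum ev_monom)
    have coeffs: "coeff (\<Sum>j\<le>d. monom (c j) j) k = (if k \<le> d then c k else 0)" for k and c :: "nat \<Rightarrow> 'a"
      by (simp add: coeff_sum coeff_monom)
    have indep: "\<forall>j\<le>d. c j = 0" if "(\<Sum>j\<le>d. scale (c j) (?v j)) = 0" for c
    proof -
      define f where "f = (\<Sum>j\<le>d. monom (c j) j)"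
      have "ev f x = 0"
        using that sum by (simp add: f_def)
      have "r dvd f"
      proof (rule ccontr)
        assume "\<not> r dvd f"
        then obtain a b where "a * f + b * r = 1"
          using irreducible_bezout[OF r] by metis
        then have "x = ev (a * f + b * r) x"
          by simp
        also have "\<dots> = 0"
          by (simp add: ev_add ev_mult \<open>ev f x = 0\<close> x(2) ev.zero)
        finally show False
          using x(1) by simp
      qed
      have "f = 0"
      proof (rule ccontr)
        assume "f \<noteq> 0"
        then have "Suc d \<le> degree f"
          using \<open>r dvd f\<close> deg dvd_imp_degree_le by metis
        then show False
          using \<open>f \<noteq> 0\<close> coeffs[of c "degree f"] by (simp add: f_def[symmetric])
      qed
      then show ?thesis
        using coeffs[of c] by (simp add: f_def) metis
    qed
    have inj: "inj_on ?v {..d}"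
    proof (rule inj_onI, rule ccontr)
      fix i j assume ij: "i \<in> {..d}" "j \<in> {..d}" "?v i = ?v j" "i \<noteq> j"
      let ?c = "\<lambda>k. (if k = i then 1 else 0) - (if k = j then 1 else 0) :: 'a"
      have "(\<Sum>k\<le>d. scale (?c k) (?v k)) = (\<Sum>k\<le>d. if k = i then ?v k else 0) - (\<Sum>k\<le>d. if k = j then ?v k else 0)"
        unfolding sum_subtractf[symmetric] by (intro sum.cong) (auto simp: scale_left_diff_distrib)
      also have "\<dots> = 0"
        using ij by simp
      finally show False
        using indep[of ?c] ij by (auto split: if_splits)
    qed
    have ind: "independent (?v ` {..d})"
    proof (rule independent_if_scalars_zero)
      fix f v assume s: "(\<Sum>v\<in>?v ` {..d}. scale (f v) v) = 0" and v: "v \<in> ?v ` {..d}"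
      have "(\<Sum>j\<le>d. scale (f (?v j)) (?v j)) = 0"
        using s inj by (simp add: sum.reindex)
      from indep[OF this] v show "f v = 0"
        by auto
    qed simp
    \<comment> \<open>The order of \<open>x\<close> has degree d + 1, so its first d + 1 iterates
      are independent and a linear form can single out the last one. Applied to \<open>c\<close> it
      returns the leading coefficient of \<open>g\<close>, which is nonzero.\<close>
    obtain \<phi> where \<phi>: "Vector_Spaces.linear scale (*) \<phi>"
      and \<phi>_v: "\<forall>v\<in>?v ` {..d}. \<phi> v = (if v = ?v d then 1 else 0)"
      using vp.linear_independent_extend[OF ind, of "\<lambda>v. if v = ?v d then 1 else 0"] by blast
    interpret \<phi>: Vector_Spaces.linear scale "(*)" \<phi>
      by (rule \<phi>)
    have \<phi>_eq: "\<phi> (?v j) = (if j = d then 1 else 0)" if "j \<le> d" for j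
      using \<phi>_v inj that by (auto simp: inj_on_def)
    have \<phi>_R: "\<phi> v = (\<Sum>i\<in>Basis. \<phi> i * R v i)" for v
    proof -
      have "\<phi> v = \<phi> (\<Sum>i\<in>Basis. scale (R v i) i)"
        by (simp add: R_sum)
      then show ?thesis
        by (simp add: \<phi>.sum \<phi>.scale mult.commute)
    qed
    have "0 = (\<Sum>i\<in>Basis. to_ac (\<phi> i) * c i)"
      using c0 by simp
    also have "\<dots> = (\<Sum>i\<in>Basis. \<Sum>j\<le>d. coeff g j * (to_ac (\<phi> i) * to_ac (R (?v j) i)))"
      by (simp add: c_def sum_distrib_left mult.left_commute)
    also have "\<dots> = (\<Sum>j\<le>d. coeff g j * (\<Sum>i\<in>Basis. to_ac (\<phi> i) * to_ac (R (?v j) i)))"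
      unfolding sum_distrib_left by (rule sum.swap)
    also have "\<dots> = (\<Sum>j\<le>d. coeff g j * to_ac (\<phi> (?v j)))"
      by (subst \<phi>_R) (simp add: to_ac_sum)
    also have "\<dots> = (\<Sum>j\<le>d. if j = d then coeff g j else 0)"
      by (intro sum.cong) (auto simp: \<phi>_eq)
    also have "\<dots> = coeff g d"
      by simp
    finally show False
      using \<open>g \<noteq> 0\<close> by (simp add: d_def)
  qed
  ultimately show ?thesis
    unfolding eigenvalues_ac_def R_def by blast
qed

text \<open>A root of an irreducible factor of the minimal polynomial is an eigenvalue, hence a root
  of p minus y or z, that is, a root of p(t + y) or p(t + z). So each irreducible factor divides the
  product of these two.\<close>

lemma exceptional_imp_annihilated:
  assumes exc: "pq_exceptional p ([:- y, 1:] * [:- z, 1:]) scale Basis u"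
  obtains N where "\<And>x. ev (pcompose p [:y, 1:] ^ N * pcompose p [:z, 1:] ^ N) x = 0"
proof -
  let ?P = "pcompose p [:y, 1:]" and ?Q = "pcompose p [:z, 1:]"
  obtain f0 where f0: "f0 \<noteq> 0 \<and> (\<forall>x. ev f0 x = 0)"
    using exists_annihilator by blast
  \<comment> \<open>A minimal polynomial up to a scalar. Minimality ensures that the cofactor of an
    irreducible factor \<open>r\<close> does not kill everything, which yields a nonzero vector
    killed by r(u).\<close>
  obtain f where f: "f \<noteq> 0" "\<And>x. ev f x = 0"
    and least: "\<And>h. h \<noteq> 0 \<Longrightarrow> (\<forall>x. ev h x = 0) \<Longrightarrow> degree f \<le> degree h"
    using ex_has_least_nat[of "\<lambda>f. f \<noteq> 0 \<and> (\<forall>x. ev f x = 0)" f0 degree, OF f0] by blast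
  have "r dvd ?P * ?Q" if r: "irreducible r" "r dvd f" for r
  proof -
    obtain h where h: "f = r * h"
      using r(2) by (elim dvdE)
    have "degree r > 0"
      using r(1) by (metis gr0I irreducible_def is_unit_iff_degree)
    moreover have "h \<noteq> 0" "r \<noteq> 0"
      using h f(1) by auto
    ultimately have "degree h < degree f"
      using h by (simp add: degree_mult_eq)
    then obtain x where x: "ev h x \<noteq> 0"
      using least \<open>h \<noteq> 0\<close> by (meson not_le)
    have "degree (map_poly to_ac r) \<noteq> 0"
      using \<open>degree r > 0\<close> by (simp add: degree_map_poly)
    then obtain a where a: "poly (map_poly to_ac r) a = 0"
      using alg_closed_imp_poly_has_root by blast
    have "a \<in> eigenvalues_ac scale Basis u"
      using root_imp_eigenvalue[OF r(1) x _ a] f(2) h by (simp add: ev_mult)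
    then obtain b c where bc: "a = b - c" "b \<in> Root p" "c \<in> Root ([:- y, 1:] * [:- z, 1:])"
      using exc by (auto simp: pq_exceptional_def)
    have "poly (map_poly to_ac ([:- y, 1:] * [:- z, 1:])) c = (c - to_ac y) * (c - to_ac z)"
      by (simp add: map_poly_pCons algebra_simps)
    then have "c = to_ac y \<or> c = to_ac z"
      using bc(3) by (simp add: Root_def)
    moreover have "poly (map_poly to_ac (pcompose p [:w, 1:])) a = 0" if "c = to_ac w" for w
    proof -
      have "poly (map_poly to_ac (pcompose p [:w, 1:])) x = poly (map_poly to_ac p) (x + to_ac w)" for x
      proof (induction p)
        case (pCons e p)
        have "map_poly to_ac ([:w, 1:] * g) = [:to_ac w, 1:] * map_poly to_ac g" for g
          by (intro poly_eqI) (simp add: coeff_map_poly coeff_pCons split: nat.split)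
        moreover have "map_poly to_ac (g + h) = map_poly to_ac g + map_poly to_ac h" for g h :: "'a poly"
          by (intro poly_eqI) (simp add: coeff_map_poly)
        ultimately show ?case
          using pCons.IH by (simp add: pcompose_pCons map_poly_pCons algebra_simps)
      qed simp
      then show ?thesis
        using that bc(1,2) by (simp add: Root_def)
    qed
    ultimately have "r dvd ?P \<or> r dvd ?Q"
      using irreducible_common_root_dvd[OF r(1) a] by blast
    then show ?thesis
      by (elim disjE) (simp_all only: dvd_mult dvd_mult2)
  qed
  then have "f dvd (?P * ?Q) ^ degree f"
    by (intro dvd_power_if_irreducible_factors_dvd f(1))
  then have "ev (?P ^ degree f * ?Q ^ degree f) x = 0" for x
    using ev_dvd_0[OF _ f(2)] by (simp add: power_mult_distrib)
  then show thesis
    by (rule that)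
qed

end

subsection \<open>Intertwined sequences give differences\<close>

lemma irreducible_pcompose_shift:
  fixes p :: "'a::field poly"
  assumes "irreducible p"
  shows "irreducible (pcompose p [:y, 1:])"
proof (rule irreducibleI)
  have inv: "pcompose (pcompose f [:w, 1:]) [:- w, 1:] = f" for f :: "'a poly" and w
    by (simp add: pcompose_assoc[symmetric] pcompose_pCons pcompose_idR)
  have unit: "pcompose f [:w, 1:] dvd 1 \<longleftrightarrow> f dvd 1" for f :: "'a poly" and w
    by (cases "f = 0") (auto simp: is_unit_iff_degree pcompose_eq_0_iff degree_pcompose)
  show "pcompose p [:y, 1:] \<noteq> 0"
    using assms inv[of p y] by auto
  show "\<not> pcompose p [:y, 1:] dvd 1"
    using assms unit irreducible_not_unit by blast
  fix a b assume "pcompose p [:y, 1:] = a * b"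
  then have "p = pcompose a [:- y, 1:] * pcompose b [:- y, 1:]"
    using inv[of p y] by (simp add: pcompose_mult)
  then show "a dvd 1 \<or> b dvd 1"
    using irreducibleD[OF assms] unit by blast
qed

context lin_endo
begin

text \<open>Bezout for P^N and Q^N gives the projections onto the two kernels; \<open>kill\<close>
  rules out any further primary component.\<close>

lemma two_primary_decomposition:
  assumes P: "irreducible P" "lead_coeff P = 1" and Q: "irreducible Q" "lead_coeff Q = 1"
    and ne: "P \<noteq> Q" and kill: "\<And>x. ev (P ^ N * Q ^ N) x = 0"
  obtains V W m x k n y l where "submodule V" "submodule W" "V \<inter> W = {0}"
    "\<And>s. \<exists>a\<in>V. \<exists>b\<in>W. s = a + b"
    "cyclic_family V m x (\<lambda>i. P ^ k i)" "\<And>i. k i \<ge> 1 \<longleftrightarrow> i < m" "antimono k"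
    "cyclic_family W n y (\<lambda>i. Q ^ l i)" "\<And>i. l i \<ge> 1 \<longleftrightarrow> i < n" "antimono l"
proof -
  define V where "V = {x. ev (P ^ N) x = 0}"
  define W where "W = {x. ev (Q ^ N) x = 0}"
  have sub: "submodule V" "submodule W"
    unfolding V_def W_def by (rule submodule_kernel_ev)+
  have "\<not> P dvd Q ^ N"
    using irreducible_dvd_imp_eq[OF P(1) Q(1) P(2) Q(2)] ne
      field_poly_irreducible_imp_prime[OF P(1)] prime_elem_dvd_power by blast
  then obtain a b where ab: "a * Q ^ N + b * P ^ N = 1"
    using irreducible_power_bezout[OF P(1)] by metis
  have inter: "V \<inter> W = {0}"
  proof -
    have "x = 0" if "ev (P ^ N) x = 0" "ev (Q ^ N) x = 0" for x
    proof -
      have "x = ev (a * Q ^ N + b * P ^ N) x"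
        by (simp add: ab)
      then show ?thesis
        by (simp only: ev_add ev_mult that ev.zero add_0)
    qed
    then show ?thesis
      by (auto simp: V_def W_def ev.zero)
  qed
  have sum: "\<exists>v\<in>V. \<exists>w\<in>W. s = v + w" for s
  proof (intro bexI)
    show "s = ev (a * Q ^ N) s + ev (b * P ^ N) s"
      using arg_cong[OF ab, of "\<lambda>f. ev f s"] by (simp only: ev_add ev_1)
    have "ev (P ^ N) (ev (a * Q ^ N) s) = ev a (ev (P ^ N * Q ^ N) s)"
      by (simp only: ev_mult[symmetric] mult_ac)
    then show "ev (a * Q ^ N) s \<in> V"
      by (simp only: V_def kill ev.zero mem_Collect_eq)
    have "ev (Q ^ N) (ev (b * P ^ N) s) = ev b (ev (P ^ N * Q ^ N) s)"
      by (simp only: ev_mult[symmetric] mult_ac)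
    then show "ev (b * P ^ N) s \<in> W"
      by (simp only: W_def kill ev.zero mem_Collect_eq)
  qed
  obtain m x k where V: "cyclic_family V m x (\<lambda>i. P ^ k i)" "\<forall>i. k i \<ge> 1 \<longleftrightarrow> i < m" "antimono k"
    using primary_submodule_decomposition[OF P(1) sub(1), of N] by (auto simp: V_def)
  obtain n y l where W: "cyclic_family W n y (\<lambda>i. Q ^ l i)" "\<forall>i. l i \<ge> 1 \<longleftrightarrow> i < n" "antimono l"
    using primary_submodule_decomposition[OF Q(1) sub(2), of N] by (auto simp: W_def)
  show thesis
    using that[OF sub inter sum V(1) _ V(3) W(1) _ W(3)] V(2) W(2) by blast
qed

lemma is_primary_decomposition_append:
  assumes P: "irreducible P" "lead_coeff P = 1" and Q: "irreducible Q" "lead_coeff Q = 1"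
    and V: "cyclic_family V m x (\<lambda>i. P ^ k i)" "submodule V" "\<And>i. k i \<ge> 1 \<longleftrightarrow> i < m"
    and W: "cyclic_family W n y (\<lambda>i. Q ^ l i)" "submodule W" "\<And>i. l i \<ge> 1 \<longleftrightarrow> i < n"
    and sum: "V \<inter> W = {0}" "\<And>s. \<exists>a\<in>V. \<exists>b\<in>W. s = a + b"
  shows "is_primary_decomposition scale UNIV u (map x [0..<m] @ map y [0..<n])
    (map (\<lambda>i. P ^ k i) [0..<m] @ map (\<lambda>i. Q ^ l i) [0..<n])"
  unfolding is_primary_decomposition_iff_cyclic_family
proof (intro conjI)
  have cong: "cyclic_family S M x' d' \<longleftrightarrow> cyclic_family S M x'' d''"
    if "\<And>i. i < M \<Longrightarrow> x' i = x'' i" "\<And>i. i < M \<Longrightarrow> d' i = d'' i" for S M x' d' x'' d''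
    using that by (simp add: cyclic_family_def cong: sum.cong_simp)
  show "cyclic_family UNIV (length (map (\<lambda>i. P ^ k i) [0..<m] @ map (\<lambda>i. Q ^ l i) [0..<n]))
      ((!) (map x [0..<m] @ map y [0..<n]))
      ((!) (map (\<lambda>i. P ^ k i) [0..<m] @ map (\<lambda>i. Q ^ l i) [0..<n]))"
    using cyclic_family_append[OF V(1,2) W(1,2) sum]
    by (subst cong) (auto simp: nth_append)
  show "\<forall>d\<in>set (map (\<lambda>i. P ^ k i) [0..<m] @ map (\<lambda>i. Q ^ l i) [0..<n]).
      \<exists>r l. irreducible r \<and> lead_coeff r = 1 \<and> l \<ge> 1 \<and> d = r ^ l"
  proof
    fix d assume "d \<in> set (map (\<lambda>i. P ^ k i) [0..<m] @ map (\<lambda>i. Q ^ l i) [0..<n])"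
    then consider i where "i < m" "d = P ^ k i" | i where "i < n" "d = Q ^ l i"
      by auto
    then show "\<exists>r l. irreducible r \<and> lead_coeff r = 1 \<and> l \<ge> 1 \<and> d = r ^ l"
    proof cases
      case (1 i)
      then show ?thesis
        using P V(3)[of i] by blast
    next
      case (2 i)
      then show ?thesis
        using Q W(3)[of i] by blast
    qed
  qed
qed simp

text \<open>Only the multiset of \<open>ds\<close> is prescribed, so powers of Q are counted by
  exchanging the two parts. At j = 0 the set on the right would be infinite.\<close>

lemma n_elem_div_append:
  assumes P: "irreducible P" "lead_coeff P = 1" and Q: "irreducible Q" "lead_coeff Q = 1"
    and ne: "P \<noteq> Q" and k: "\<And>i. k i \<ge> 1 \<longleftrightarrow> i < m"
    and dec: "is_primary_decomposition scale UNIV u xs ds"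
    and ds: "mset ds = mset (map (\<lambda>i. P ^ k i) [0..<m]) + mset (map (\<lambda>i. Q ^ l i) [0..<n])"
    and j: "j \<ge> 1"
  shows "n_elem_div scale UNIV u P j = card {i. k i \<ge> j}"
proof -
  have P_iff: "(\<exists>h\<ge>j. P ^ k i = P ^ h) \<longleftrightarrow> k i \<ge> j" for i
    using irreducible_power_inject[OF P(1,1,2,2) _ sym] j by (metis order_trans)
  have Q_iff: "\<not> (\<exists>h\<ge>j. Q ^ l i = P ^ h)" for i
    using irreducible_power_inject[OF P(1) Q(1) P(2) Q(2) _ sym] j ne by (metis order_trans)
  have "n_elem_div scale UNIV u P j
      = size {#d \<in># mset (map (\<lambda>i. P ^ k i) [0..<m]). \<exists>h\<ge>j. d = P ^ h#}
      + size {#d \<in># mset (map (\<lambda>i. Q ^ l i) [0..<n]). \<exists>h\<ge>j. d = P ^ h#}"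
    by (simp only: n_elem_div_eq[OF dec] ds filter_union_mset size_union)
  also have "{#d \<in># mset (map (\<lambda>i. Q ^ l i) [0..<n]). \<exists>h\<ge>j. d = P ^ h#} = {#}"
    by (simp add: filter_map comp_def Q_iff del: mset_filter mset_map flip: mset_filter)
  also have "size {#d \<in># mset (map (\<lambda>i. P ^ k i) [0..<m]). \<exists>h\<ge>j. d = P ^ h#}
      = length (filter (\<lambda>i. k i \<ge> j) [0..<m])"
    by (simp only: mset_filter[symmetric] size_mset filter_map length_map comp_def P_iff)
  also have "\<dots> = card {i. i < m \<and> k i \<ge> j}"
    unfolding length_filter_conv_card by (rule arg_cong[where f = card]) auto
  also have "{i. i < m \<and> k i \<ge> j} = {i. k i \<ge> j}"
    using k j by (auto simp flip: k)
  finally show ?thesis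
    by simp
qed

text \<open>The annihilating product supplies an actual decomposition, so the abstract count can be
  evaluated as a dimension.\<close>

lemma dim_kernel_inter_range_eq_n_elem_div:
  assumes P: "irreducible P" "lead_coeff P = 1" and Q: "irreducible Q" "lead_coeff Q = 1"
    and ne: "P \<noteq> Q" and kill: "\<And>x. ev (P ^ N * Q ^ N) x = 0"
    and r: "irreducible r" "lead_coeff r = 1"
  shows "dim ({x. ev r x = 0} \<inter> range (ev (r ^ k))) = degree r * n_elem_div scale UNIV u r (Suc k)"
proof -
  obtain V W m x k n y l where dec: "submodule V" "submodule W" "V \<inter> W = {0}"
    "\<And>s. \<exists>a\<in>V. \<exists>b\<in>W. s = a + b"
    "cyclic_family V m x (\<lambda>i. P ^ k i)" "\<And>i. k i \<ge> 1 \<longleftrightarrow> i < m" "antimono k"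
    "cyclic_family W n y (\<lambda>i. Q ^ l i)" "\<And>i. l i \<ge> 1 \<longleftrightarrow> i < n" "antimono l"
    using two_primary_decomposition[OF P Q ne kill] by blast
  note dec' = is_primary_decomposition_append[OF P Q dec(5,1,6) dec(8,2,9) dec(3,4)]
  show ?thesis
    by (simp only: dim_kernel_inter_range[OF dec' r] n_elem_div_eq[OF dec'])
qed

text \<open>Intertwining says that the sorted exponents of P and Q differ by at most 1 at each
  index. Merging the summands index by index gives modules on which \<open>quad\<close> acts; u + b
  then plays the part of the first endomorphism.\<close>

lemma intertwined_imp_difference:
  assumes P: "irreducible P" "lead_coeff P = 1" "P = pcompose [:n, - t, 1:] [:y, 1:]"
    and Q: "irreducible Q" "lead_coeff Q = 1" "Q = pcompose [:n, - t, 1:] [:z, 1:]"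
    and ne: "P \<noteq> Q" and kill: "\<And>x. ev (P ^ N * Q ^ N) x = 0"
    and inter: "intertwined 1 (n_elem_div scale UNIV u P) (n_elem_div scale UNIV u Q)"
  obtains b where "Vector_Spaces.linear scale scale b"
    and "\<And>x. b (b x) = scale (y + z) (b x) - scale (y * z) x"
    and "\<And>x. u (u x + b x) + b (u x + b x) = scale t (u x + b x) - scale n x"
proof -
  obtain V W m1 x1 k1 m2 x2 k2 where dec: "submodule V" "submodule W" "V \<inter> W = {0}"
    "\<And>s. \<exists>a\<in>V. \<exists>b\<in>W. s = a + b"
    "cyclic_family V m1 x1 (\<lambda>i. P ^ k1 i)" "\<And>i. k1 i \<ge> 1 \<longleftrightarrow> i < m1" "antimono k1"
    "cyclic_family W m2 x2 (\<lambda>i. Q ^ k2 i)" "\<And>i. k2 i \<ge> 1 \<longleftrightarrow> i < m2" "antimono k2"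
    using two_primary_decomposition[OF P(1,2) Q(1,2) ne kill] by blast
  note dec' = is_primary_decomposition_append[OF P(1,2) Q(1,2) dec(5,1,6) dec(8,2,9) dec(3,4)]
  have nP: "n_elem_div scale UNIV u P j = card {i. k1 i \<ge> j}" if "j \<ge> 1" for j
    using n_elem_div_append[OF P(1,2) Q(1,2) ne dec(6) dec' _ that] by simp
  have nQ: "n_elem_div scale UNIV u Q j = card {i. k2 i \<ge> j}" if "j \<ge> 1" for j
    using n_elem_div_append[OF Q(1,2) P(1,2) ne[symmetric] dec(9) dec' _ that]
    by (simp add: add.commute)
  have fin1: "finite {i. k1 i \<ge> j}" if "j \<ge> 1" for j
  proof -
    have "{i. k1 i \<ge> j} \<subseteq> {..<m1}"
      using dec(6) that order_trans by fastforce
    then show ?thesis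
      using finite_subset by blast
  qed
  have fin2: "finite {i. k2 i \<ge> j}" if "j \<ge> 1" for j
  proof -
    have "{i. k2 i \<ge> j} \<subseteq> {..<m2}"
      using dec(9) that order_trans by fastforce
    then show ?thesis
      using finite_subset by blast
  qed
  \<comment> \<open>If k1 i \<ge> k2 i + 2, then i lies below the count for P at k2 i + 2, hence
    below the count for Q at k2 i + 1, which says k2 i \<ge> k2 i + 1.\<close>
  have le1: "k1 i \<le> Suc (k2 i)" for i
  proof (rule ccontr)
    assume "\<not> k1 i \<le> Suc (k2 i)"
    then have "k1 i \<ge> Suc (k2 i) + 1"
      by simp
    then have "i < n_elem_div scale UNIV u P (Suc (k2 i) + 1)"
      using antimono_card_level_set[OF dec(7) fin1] nP by simp
    also have "\<dots> \<le> n_elem_div scale UNIV u Q (Suc (k2 i))"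
      using inter by (simp add: intertwined_def)
    finally show False
      using antimono_card_level_set[OF dec(10) fin2, of "Suc (k2 i)" i] nQ by simp
  qed
  have le2: "k2 i \<le> Suc (k1 i)" for i
  proof (rule ccontr)
    assume "\<not> k2 i \<le> Suc (k1 i)"
    then have "k2 i \<ge> Suc (k1 i) + 1"
      by simp
    then have "i < n_elem_div scale UNIV u Q (Suc (k1 i) + 1)"
      using antimono_card_level_set[OF dec(10) fin2] nQ by simp
    also have "\<dots> \<le> n_elem_div scale UNIV u P (Suc (k1 i))"
      using inter by (simp add: intertwined_def)
    finally show False
      using antimono_card_level_set[OF dec(7) fin1, of "Suc (k1 i)" i] nP by simp
  qed
  define M where "M = max m1 m2"
  have k1_0: "P ^ k1 i = 1" if "m1 \<le> i" for i
    using dec(6)[of i] that by (cases "k1 i") auto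
  have k2_0: "Q ^ k2 i = 1" if "m2 \<le> i" for i
    using dec(9)[of i] that by (cases "k2 i") auto
  have zero_mem: "0 \<in> V" "0 \<in> W"
    using dec(3) by blast+
  define x where "x i = (if i < m1 then x1 i else 0) + (if i < m2 then x2 i else 0)" for i
  define e where "e i = P ^ k1 i * Q ^ k2 i" for i
  have "\<not> P dvd Q ^ j" for j
    using irreducible_dvd_imp_eq[OF P(1) Q(1) P(2) Q(2)] ne
      field_poly_irreducible_imp_prime[OF P(1)] prime_elem_dvd_power by blast
  then have "\<exists>a b. a * P ^ k1 i + b * Q ^ k2 i = 1" for i
    by (metis irreducible_power_bezout[OF P(1)] add.commute)
  then have cyc: "cyclic_family UNIV M x e"
    unfolding x_def e_def
    by (intro cyclic_family_merge[OF _ dec(1) _ dec(2) dec(3,4)]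
        cyclic_family_pad dec(5,8) k1_0 k2_0 zero_mem) (auto simp: M_def)
  interpret q1: quadratic_pair n t y z P Q
    using P(3) Q(3) ne by unfold_locales
  interpret q2: quadratic_pair n t z y Q P
    using P(3) Q(3) ne by unfold_locales auto
  \<comment> \<open>The instance is chosen so that the polynomial with the possibly larger exponent
    takes the place of P in \<open>quad_dvd\<close>.\<close>
  define \<beta> where "\<beta> i = (if k2 i \<le> k1 i then q1.quad else q2.quad)" for i
  have \<beta>_dvd: "e i dvd \<beta> i f" if "e i dvd f" for i f
  proof (cases "k2 i \<le> k1 i")
    case True
    then have "k1 i = k2 i \<or> k1 i = Suc (k2 i)"
      using le1[of i] by linarith
    then show ?thesis
      using q1.quad_dvd that True by (simp add: e_def \<beta>_def)
  next
    case False
    then have "k2 i = k1 i \<or> k2 i = Suc (k1 i)"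
      using le2[of i] by linarith
    then show ?thesis
      using q2.quad_dvd[of "k2 i" "k1 i" f] that False by (simp add: e_def \<beta>_def mult.commute)
  qed
  have \<beta>_linear: "\<beta> i (f - g) = \<beta> i f - \<beta> i g" "\<beta> i (f + g) = \<beta> i f + \<beta> i g"
    "\<beta> i (smult c f) = smult c (\<beta> i f)" for i c f g
    by (simp_all add: \<beta>_def q1.quad_diff q2.quad_diff q1.quad_add q2.quad_add q1.quad_smult q2.quad_smult)
  obtain b where b: "Vector_Spaces.linear scale scale b"
    "\<And>f. b (\<Sum>i<M. ev (f i) (x i)) = (\<Sum>i<M. ev (\<beta> i (f i)) (x i))"
    using operator_from_cyclic_family[OF cyc \<beta>_linear \<beta>_dvd] by blast
  have gen: "\<exists>f. s = (\<Sum>i<M. ev (f i) (x i))" for s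
    using cyc by (simp add: cyclic_family_def)
  have bb: "\<beta> i (\<beta> i f) = smult (y + z) (\<beta> i f) - smult (y * z) f" for i f
    using q1.quad_quad q2.quad_quad by (simp add: \<beta>_def add.commute mult.commute)
  have aa: "[:0, 1:] * ([:0, 1:] * f + \<beta> i f) + \<beta> i ([:0, 1:] * f + \<beta> i f)
      = smult t ([:0, 1:] * f + \<beta> i f) - smult n f" for i f
    by (cases "k2 i \<le> k1 i") (simp_all only: \<beta>_def q1.shift_plus_quad_twice q2.shift_plus_quad_twice if_True if_False)
  have u_sum: "u (\<Sum>i<M. ev (f i) (x i)) = (\<Sum>i<M. ev ([:0, 1:] * f i) (x i))" for f
    by (simp only: u.sum ev_mult ev_X)
  show thesis
  proof (rule that[OF b(1)])
    fix s
    obtain f where s: "s = (\<Sum>i<M. ev (f i) (x i))"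
      using gen by blast
    show "b (b s) = scale (y + z) (b s) - scale (y * z) s"
      by (simp only: s b(2) bb ev_diff ev_smult sum_subtractf scale_sum_right)
    define h where "h i = [:0, 1:] * f i + \<beta> i (f i)" for i
    have h: "u s + b s = (\<Sum>i<M. ev (h i) (x i))"
      by (simp only: s b(2) u_sum ev_add sum.distrib h_def)
    have "u (\<Sum>i<M. ev (h i) (x i)) + b (\<Sum>i<M. ev (h i) (x i))
        = (\<Sum>i<M. ev ([:0, 1:] * h i + \<beta> i (h i)) (x i))"
      by (simp only: b(2) u_sum ev_add sum.distrib)
    also have "\<dots> = (\<Sum>i<M. ev (smult t (h i) - smult n (f i)) (x i))"
      by (simp only: h_def aa)
    also have "\<dots> = scale t (\<Sum>i<M. ev (h i) (x i)) - scale n s"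
      by (simp only: s ev_diff ev_smult sum_subtractf scale_sum_right)
    finally show "u (u s + b s) + b (u s + b s) = scale t (u s + b s) - scale n s"
      by (simp only: h)
  qed
qed

end

subsection \<open>Transposition\<close>

text \<open>The symmetric form attached to the basis identifies the dual space with the space itself, so
  that \<open>h(v)\<close> becomes an endomorphism of a type with carrier \<^term>\<open>UNIV\<close>.\<close>

context finite_dimensional_vector_space
begin

definition coord_form :: "'b \<Rightarrow> 'b \<Rightarrow> 'a" where
  "coord_form x y = (\<Sum>i\<in>Basis. representation Basis x i * representation Basis y i)"

definition riesz :: "('b \<Rightarrow> 'a) \<Rightarrow> 'b" where
  "riesz \<phi> = (\<Sum>i\<in>Basis. scale (\<phi> i) i)"

lemma coord_form_sym: "coord_form x y = coord_form y x"
  by (simp add: coord_form_def mult.commute)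

lemma coord_form_add_left: "coord_form (x + x') y = coord_form x y + coord_form x' y"
  by (simp add: coord_form_def representation_add independent_Basis span_Basis sum.distrib distrib_right)

lemma coord_form_scale_left: "coord_form (scale c x) y = c * coord_form x y"
  by (simp add: coord_form_def representation_scale independent_Basis span_Basis sum_distrib_left mult.assoc)

lemma coord_form_add_right: "coord_form y (x + x') = coord_form y x + coord_form y x'"
  by (metis coord_form_add_left coord_form_sym)

lemma coord_form_scale_right: "coord_form y (scale c x) = c * coord_form y x"
  by (metis coord_form_scale_left coord_form_sym)

lemma coord_form_zero_right: "coord_form y 0 = 0"
  using coord_form_scale_right[of y 0 0] by simp

lemma coord_form_sum_right: "coord_form y (\<Sum>i\<in>I. f i) = (\<Sum>i\<in>I. coord_form y (f i))"
  by (induction I rule: infinite_finite_induct) (simp_all add: coord_form_add_right coord_form_zero_right)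

lemma coord_form_basis: "i \<in> Basis \<Longrightarrow> coord_form x i = representation Basis x i"
  using finite_Basis
  by (simp add: coord_form_def representation_basis independent_Basis if_distrib cong: if_cong)

lemma sum_coord_form: "(\<Sum>i\<in>Basis. scale (coord_form x i) i) = x"
proof -
  have "(\<Sum>i\<in>Basis. scale (coord_form x i) i) = (\<Sum>i\<in>Basis. scale (representation Basis x i) i)"
    by (simp add: coord_form_basis)
  also have "\<dots> = x"
    using finite_Basis by (intro sum_representation_eq independent_Basis) (auto simp: span_Basis)
  finally show ?thesis .
qed

lemma coord_form_nondegenerate:
  assumes "\<And>x. coord_form x y = coord_form x z"
  shows "y = z"
  using sum_coord_form[of y] sum_coord_form[of z] assms by (simp add: coord_form_sym)

lemma coord_form_riesz:
  assumes "Vector_Spaces.linear scale (*) \<phi>"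
  shows "coord_form x (riesz \<phi>) = \<phi> x"
proof -
  interpret \<phi>: Vector_Spaces.linear scale "(*)" \<phi>
    by (rule assms)
  have "\<phi> x = \<phi> (\<Sum>i\<in>Basis. scale (coord_form x i) i)"
    by (simp only: sum_coord_form)
  also have "\<dots> = (\<Sum>i\<in>Basis. \<phi> i * coord_form x i)"
    by (simp add: \<phi>.sum \<phi>.scale mult.commute)
  finally show ?thesis
    by (simp add: riesz_def coord_form_sum_right coord_form_scale_right)
qed

lemma linear_coord_form: "Vector_Spaces.linear scale (*) (\<lambda>x. coord_form x y)"
  unfolding Vector_Spaces.linear_iff
  by (intro conjI vector_space_axioms vector_space.intro)
    (simp_all add: algebra_simps coord_form_add_left coord_form_scale_left)

text \<open>Row rank against column rank: in a basis \<open>E\<close> of the range of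
  \<open>f\<close> the coordinates of f x are linear forms in x. The vectors representing these
  forms, one for each element of \<open>E\<close>, span the range of \<open>g\<close>.\<close>

lemma dim_range_adjoint_le:
  assumes f: "Vector_Spaces.linear scale scale f"
    and adj: "\<And>x y. coord_form (f x) y = coord_form x (g y)"
  shows "dim (range g) \<le> dim (range f)"
proof -
  interpret f: Vector_Spaces.linear scale scale f
    by (rule f)
  obtain E where E: "E \<subseteq> range f" "independent E" "range f \<subseteq> span E" "card E = dim (range f)"
    using basis_exists by blast
  have finE: "finite E"
    using E(2) finiteI_independent by blast
  have fE: "f x \<in> span E" for x
    using E(3) by blast
  define y where "y e = riesz (\<lambda>x. representation E (f x) e)" for e
  have "Vector_Spaces.linear scale (*) (\<lambda>x. representation E (f x) e)" for e
    unfolding Vector_Spaces.linear_iff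
    by (intro conjI vector_space_axioms vector_space.intro)
      (simp_all add: algebra_simps f.add f.scale representation_add[OF E(2) fE fE]
        representation_scale[OF E(2) fE])
  then have y: "coord_form x (y e) = representation E (f x) e" for x e
    unfolding y_def by (rule coord_form_riesz)
  have "g z = (\<Sum>e\<in>E. scale (coord_form z e) (y e))" for z
  proof (rule coord_form_nondegenerate)
    fix x
    have "coord_form x (g z) = coord_form z (f x)"
      by (metis adj coord_form_sym)
    also have "f x = (\<Sum>e\<in>E. scale (representation E (f x) e) e)"
      using sum_representation_eq[OF E(2) fE finE subset_refl] by simp
    finally show "coord_form x (g z) = coord_form x (\<Sum>e\<in>E. scale (coord_form z e) (y e))"
      by (simp add: coord_form_sum_right coord_form_scale_right y mult.commute)
  qed
  then have "g z \<in> span (y ` E)" for z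
    by (simp add: span_sum span_scale span_base)
  then have "range g \<subseteq> span (y ` E)"
    by blast
  then have "dim (range g) \<le> card (y ` E)"
    using finE by (intro dim_le_card) auto
  also have "\<dots> \<le> card E"
    using finE by (rule card_image_le)
  finally show ?thesis
    using E(4) by simp
qed

end

section \<open>Ranks under transposition and on the doubled space\<close>

context lin_endo
begin

text \<open>Rank-nullity for r(u) on the range of r(u)^k. It expresses the counted dimensions by
  ranks alone, and ranks survive transposition.\<close>

lemma dim_range_ev_power:
  "dim (range (ev (r ^ k))) = dim (range (ev (r ^ Suc k))) + dim ({x. ev r x = 0} \<inter> range (ev (r ^ k)))"
proof -
  have "ev r ` range (ev (r ^ k)) = range (ev (r ^ Suc k))"
    by (auto simp: ev_mult)
  moreover have "{x \<in> range (ev (r ^ k)). ev r x = 0} = {x. ev r x = 0} \<inter> range (ev (r ^ k))"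
    by blast
  ultimately show ?thesis
    using rank_nullity[OF linear_ev[of r] ev.subspace_image[OF subspace_UNIV, of "r ^ k"]] by simp
qed

definition adjoint :: "'b \<Rightarrow> 'b" where
  "adjoint y = riesz (\<lambda>x. coord_form (u x) y)"

lemma coord_form_adjoint: "coord_form x (adjoint y) = coord_form (u x) y"
proof -
  have "Vector_Spaces.linear scale (*) (\<lambda>x. coord_form (u x) y)"
    unfolding Vector_Spaces.linear_iff
    by (intro conjI vector_space_axioms vector_space.intro)
      (simp_all add: algebra_simps u.add u.scale coord_form_add_left coord_form_scale_left)
  then show ?thesis
    unfolding adjoint_def by (rule coord_form_riesz)
qed

lemma lin_endo_adjoint: "lin_endo scale Basis adjoint"
proof unfold_locales
  fix x y c
  show "adjoint (x + y) = adjoint x + adjoint y"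
    by (rule coord_form_nondegenerate) (simp add: coord_form_adjoint coord_form_add_right)
  show "adjoint (scale c x) = scale c (adjoint x)"
    by (rule coord_form_nondegenerate) (simp add: coord_form_adjoint coord_form_scale_right)
qed

lemma coord_form_ev_adjoint: "coord_form x (poly_end scale f adjoint y) = coord_form (ev f x) y"
proof -
  interpret adj: lin_endo scale Basis adjoint
    by (rule lin_endo_adjoint)
  show ?thesis
  proof (induction f arbitrary: x)
    case 0
    show ?case
      using coord_form_scale_left[of 0 0 y] by (simp add: coord_form_zero_right)
  next
    case (pCons a f)
    have "ev f (u x) = u (ev f x)"
      using ev_commute[of f "[:0, 1:]" x] by (simp only: ev_X)
    then show ?case
      by (simp add: ev_pCons adj.ev_pCons coord_form_add_right coord_form_add_left
          coord_form_scale_left coord_form_scale_right coord_form_adjoint pCons.IH)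
  qed
qed

lemma dim_kernel_inter_range_adjoint:
  "dim ({x. poly_end scale r adjoint x = 0} \<inter> range (poly_end scale (r ^ k) adjoint))
    = dim ({x. ev r x = 0} \<inter> range (ev (r ^ k)))"
proof -
  interpret adj: lin_endo scale Basis adjoint
    by (rule lin_endo_adjoint)
  have rank: "dim (range (adj.ev f)) = dim (range (ev f))" for f
  proof (rule antisym)
    show "dim (range (adj.ev f)) \<le> dim (range (ev f))"
      by (rule dim_range_adjoint_le[OF linear_ev]) (simp add: coord_form_ev_adjoint)
    show "dim (range (ev f)) \<le> dim (range (adj.ev f))"
      by (rule dim_range_adjoint_le[OF adj.linear_ev]) (metis coord_form_ev_adjoint coord_form_sym)
  qed
  then show ?thesis
    using dim_range_ev_power[of r k] adj.dim_range_ev_power[of r k] by simp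
qed

sublocale pair: finite_dimensional_vector_space_prod scale scale Basis Basis
  by unfold_locales

definition double :: "'b \<times> 'b \<Rightarrow> 'b \<times> 'b" where
  "double e = (u (fst e), adjoint (snd e))"

lemma double_Pair: "double (x, y) = (u x, adjoint y)"
  by (simp add: double_def)

lemma lin_endo_double: "lin_endo pair.scale pair.Basis_pair double"
proof -
  interpret adj: lin_endo scale Basis adjoint
    by (rule lin_endo_adjoint)
  show ?thesis
    by unfold_locales
      (simp_all add: double_def pair.scale_def u.add u.scale adj.u.add adj.u.scale)
qed

lemma ev_double: "poly_end pair.scale f double e = (ev f (fst e), poly_end scale f adjoint (snd e))"
proof -
  interpret adj: lin_endo scale Basis adjoint
    by (rule lin_endo_adjoint)
  interpret dbl: lin_endo pair.scale pair.Basis_pair double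
    by (rule lin_endo_double)
  show ?thesis
  proof (induction f)
    case 0
    show ?case
      by (simp only: dbl.ev_0_left ev_0_left adj.ev_0_left zero_prod_def)
  next
    case (pCons a f)
    show ?case
      using pCons.IH
      by (cases e) (simp only: dbl.ev_pCons ev_pCons adj.ev_pCons pair.scale_prod double_Pair
          fst_conv snd_conv add_Pair)
  qed
qed

text \<open>Kernels and ranges of a direct sum are products, and the transposed factor contributes
  the same dimension as \<open>u\<close>.\<close>

lemma dim_kernel_inter_range_double:
  "pair.p.dim ({e. poly_end pair.scale r double e = 0} \<inter> range (poly_end pair.scale (r ^ k) double))
    = 2 * dim ({x. ev r x = 0} \<inter> range (ev (r ^ k)))"
proof -
  interpret adj: lin_endo scale Basis adjoint
    by (rule lin_endo_adjoint)
  have "{e. poly_end pair.scale r double e = 0} \<inter> range (poly_end pair.scale (r ^ k) double)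
      = ({x. ev r x = 0} \<inter> range (ev (r ^ k))) \<times> ({x. adj.ev r x = 0} \<inter> range (adj.ev (r ^ k)))"
  proof -
    have "range (poly_end pair.scale f double) = range (ev f) \<times> range (adj.ev f)" for f
    proof (intro subset_antisym subsetI)
      fix e assume "e \<in> range (ev f) \<times> range (adj.ev f)"
      then obtain x y where "e = (ev f x, adj.ev f y)"
        by blast
      then have "e = poly_end pair.scale f double (x, y)"
        by (simp only: ev_double fst_conv snd_conv)
      then show "e \<in> range (poly_end pair.scale f double)"
        by blast
    qed (auto simp: ev_double)
    moreover have "{e. poly_end pair.scale r double e = 0} = {x. ev r x = 0} \<times> {x. adj.ev r x = 0}"
      by (auto simp: ev_double zero_prod_def)
    ultimately show ?thesis
      by (simp only: Times_Int_Times)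
  qed
  moreover have "subspace ({x. ev r x = 0} \<inter> range (ev (r ^ k)))"
    by (intro subspace_inter subspace_kernel_ev ev.subspace_image subspace_UNIV)
  moreover have "subspace ({x. adj.ev r x = 0} \<inter> range (adj.ev (r ^ k)))"
    by (intro subspace_inter adj.subspace_kernel_ev adj.ev.subspace_image subspace_UNIV)
  ultimately show ?thesis
    by (simp add: pair.dim_Times dim_kernel_inter_range_adjoint)
qed

end

subsection \<open>The symplectic extension\<close>

context lin_endo
begin

lemma End_on_UNIV_iff: "f \<in> End_on scale UNIV \<longleftrightarrow> Vector_Spaces.linear scale scale f"
  by (simp add: End_on_def Vector_Spaces.linear_iff vector_space_axioms)

text \<open>Each quadratic equation is solved for the square, a form suited to rewriting in
  computations with \<open>a\<close> and \<open>b\<close>.\<close>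

lemma difference_iff:
  assumes p: "p = [:n, - t, 1:]" and q: "q = [:- y, 1:] * [:- z, 1:]"
  shows "is_pq_difference_in_End p q scale UNIV u \<longleftrightarrow>
    (\<exists>a b. Vector_Spaces.linear scale scale a \<and> Vector_Spaces.linear scale scale b
      \<and> (\<forall>x. u x = a x - b x) \<and> (\<forall>x. a (a x) = scale t (a x) - scale n x)
      \<and> (\<forall>x. b (b x) = scale (y + z) (b x) - scale (y * z) x))"
proof -
  have "poly_end scale p a x = a (a x) - (scale t (a x) - scale n x)" for a x
    using poly_end_degree_2[of p scale a x] by (simp add: p numeral_2_eq_2)
  moreover have "poly_end scale q b x = b (b x) - (scale (y + z) (b x) - scale (y * z) x)" for b x
    using poly_end_degree_2[of q scale b x]
    by (simp add: q numeral_2_eq_2 scale_left_distrib scale_left_diff_distrib algebra_simps)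
  ultimately show ?thesis
    unfolding is_pq_difference_in_End_def Bex_def End_on_UNIV_iff by simp
qed

lemma S_form_symplectic: "symplectic_form (scale_sum_dual scale) (sum_dual scale) S_form"
proof -
  have "x = 0 \<and> \<phi> = 0" if \<phi>: "\<phi> \<in> dual scale" and z: "\<forall>y. \<forall>\<psi>\<in>dual scale. \<phi> y - \<psi> x = 0" for x \<phi>
  proof
    \<comment> \<open>This is the zero form; testing against it isolates \<phi>. The forms
      \<open>\<lambda>x. coord_form x y\<close> then separate \<open>x\<close> from 0.\<close>
    have "(\<lambda>x. coord_form x 0) \<in> dual scale"
      using linear_coord_form by (simp add: dual_def)
    then show "\<phi> = 0"
      using z by (fastforce simp: coord_form_zero_right)
    then have "coord_form y x = coord_form y 0" for y
      using z linear_coord_form[of y] coord_form_sym[of y x] by (auto simp: dual_def coord_form_zero_right)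
    then show "x = 0"
      by (rule coord_form_nondegenerate)
  qed
  moreover have "\<phi> (x + y) = \<phi> x + \<phi> y" "\<phi> (scale c x) = c * \<phi> x" if "\<phi> \<in> dual scale" for \<phi> x y c
    using that by (simp_all add: dual_def Vector_Spaces.linear_iff)
  ultimately show ?thesis
    unfolding symplectic_form_def
    by (auto simp: sum_dual_def scale_sum_dual_def S_form_def algebra_simps zero_prod_def)
qed

text \<open>The form pairs \<phi> with f x and \<phi> o f with x, and these values cancel. Extending
  both terms of a difference on V therefore gives a symplectic difference.\<close>

lemma h_ext_alternating:
  assumes "Vector_Spaces.linear scale scale f"
  shows "h_ext f \<in> alternating_End (scale_sum_dual scale) (sum_dual scale) S_form"
proof -
  interpret f: Vector_Spaces.linear scale scale f
    by (rule assms)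
  have "\<phi> \<circ> f \<in> dual scale" if "\<phi> \<in> dual scale" for \<phi>
    using that by (simp add: dual_def Vector_Spaces.linear_iff f.add f.scale)
  then show ?thesis
    by (auto simp: alternating_End_def End_on_def sum_dual_def scale_sum_dual_def h_ext_def S_form_def
        f.add f.scale fun_eq_iff)
qed

lemma poly_end_h_ext:
  assumes "degree p = 2" "\<And>x. poly_end scale p f x = 0" "w \<in> sum_dual scale"
  shows "poly_end (scale_sum_dual scale) p (h_ext f) w = 0"
proof -
  obtain x \<phi> where w: "w = (x, \<phi>)" and \<phi>: "Vector_Spaces.linear scale (*) \<phi>"
    using assms(3) by (auto simp: sum_dual_def dual_def)
  interpret \<phi>: Vector_Spaces.linear scale "(*)" \<phi>
    by (rule \<phi>)
  have "\<phi> (poly_end scale p f y) = 0" for y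
    using assms(2) \<phi>.zero by simp
  then show ?thesis
    using assms(2)[of x] unfolding poly_end_degree_2[OF assms(1)] w
    by (simp add: scale_sum_dual_def h_ext_def zero_prod_def fun_eq_iff \<phi>.add \<phi>.scale)
qed

lemma difference_imp_symplectic_difference:
  assumes "degree p = 2" "degree q = 2" "is_pq_difference_in_End p q scale UNIV u"
  shows "is_symplectic_pq_difference p q (scale_sum_dual scale) (sum_dual scale) (symplectic_extension u)"
proof -
  obtain a b where ab: "Vector_Spaces.linear scale scale a" "Vector_Spaces.linear scale scale b"
    "\<And>x. u x = a x - b x" "\<And>x. poly_end scale p a x = 0" "\<And>x. poly_end scale q b x = 0"
    using assms(3) by (auto simp: is_pq_difference_in_End_def End_on_UNIV_iff)
  have "h_ext u w = h_ext a w - h_ext b w" if w: "w \<in> sum_dual scale" for w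
  proof -
    obtain x \<phi> where w: "w = (x, \<phi>)" and \<phi>: "Vector_Spaces.linear scale (*) \<phi>"
      using w by (auto simp: sum_dual_def dual_def)
    interpret \<phi>: Vector_Spaces.linear scale "(*)" \<phi>
      by (rule \<phi>)
    show ?thesis
      by (simp add: w h_ext_def fun_eq_iff ab(3) \<phi>.diff)
  qed
  then show ?thesis
    unfolding is_symplectic_pq_difference_def symplectic_extension_def symplectic_pair_def prod.case
    using S_form_symplectic h_ext_alternating[OF linear_u] h_ext_alternating[OF ab(1)]
      h_ext_alternating[OF ab(2)] poly_end_h_ext[OF assms(1) ab(4)] poly_end_h_ext[OF assms(2) ab(5)]
    by blast
qed

section \<open>Transport from the sum with the dual to the square of the space\<close>

definition to_sum_dual :: "'b \<times> 'b \<Rightarrow> 'b \<times> ('b \<Rightarrow> 'a)" where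
  "to_sum_dual e = (fst e, \<lambda>x. coord_form x (snd e))"

lemma to_sum_dual_mem: "to_sum_dual e \<in> sum_dual scale"
  using linear_coord_form by (simp add: to_sum_dual_def sum_dual_def dual_def)

lemma to_sum_dual_surj: "w \<in> sum_dual scale \<Longrightarrow> \<exists>e. w = to_sum_dual e"
  by (intro exI[of _ "(fst w, riesz (snd w))"])
    (auto simp: sum_dual_def dual_def to_sum_dual_def coord_form_riesz)

lemma to_sum_dual_inj: "to_sum_dual e = to_sum_dual e' \<longleftrightarrow> e = e'"
  by (cases e; cases e') (auto simp: to_sum_dual_def fun_eq_iff intro: coord_form_nondegenerate)

lemma to_sum_dual_add: "to_sum_dual (e + e') = to_sum_dual e + to_sum_dual e'"
  by (simp add: to_sum_dual_def coord_form_add_right fun_eq_iff)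

lemma to_sum_dual_scale: "to_sum_dual (pair.scale c e) = scale_sum_dual scale c (to_sum_dual e)"
  by (simp add: to_sum_dual_def pair.scale_def scale_sum_dual_def coord_form_scale_right)

lemma to_sum_dual_0: "to_sum_dual 0 = 0"
  by (simp add: to_sum_dual_def zero_prod_def coord_form_zero_right fun_eq_iff)

lemma h_ext_to_sum_dual: "h_ext u (to_sum_dual e) = to_sum_dual (double e)"
  by (simp add: to_sum_dual_def h_ext_def double_def coord_form_adjoint fun_eq_iff)

lemma pull_back_End:
  assumes p: "degree p = 2" and f: "f \<in> End_on (scale_sum_dual scale) (sum_dual scale)"
    and pf: "\<And>w. w \<in> sum_dual scale \<Longrightarrow> poly_end (scale_sum_dual scale) p f w = 0"
  obtains g where "g \<in> End_on pair.scale UNIV" "\<And>e. to_sum_dual (g e) = f (to_sum_dual e)"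
    "\<And>e. poly_end pair.scale p g e = 0"
proof -
  have "\<forall>e. \<exists>e'. f (to_sum_dual e) = to_sum_dual e'"
    using f to_sum_dual_mem to_sum_dual_surj by (simp add: End_on_def)
  then obtain g where g: "\<And>e. f (to_sum_dual e) = to_sum_dual (g e)"
    by metis
  have "g \<in> End_on pair.scale UNIV"
    unfolding End_on_def
  proof (intro CollectI conjI ballI allI)
    fix e e' c
    have "to_sum_dual (g (e + e')) = to_sum_dual (g e + g e')"
      using f to_sum_dual_mem by (simp only: to_sum_dual_add g[symmetric] End_on_def mem_Collect_eq)
    then show "g (e + e') = g e + g e'"
      by (simp only: to_sum_dual_inj)
    have "to_sum_dual (g (pair.scale c e)) = to_sum_dual (pair.scale c (g e))"
      using f to_sum_dual_mem by (simp only: to_sum_dual_scale g[symmetric] End_on_def mem_Collect_eq)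
    then show "g (pair.scale c e) = pair.scale c (g e)"
      by (simp only: to_sum_dual_inj)
  qed simp
  moreover have "poly_end pair.scale p g e = 0" for e
    using pf[OF to_sum_dual_mem[of e]] unfolding poly_end_degree_2[OF p]
    by (simp add: g to_sum_dual_0 flip: to_sum_dual_scale to_sum_dual_add)
      (simp add: to_sum_dual_inj flip: to_sum_dual_0)
  ultimately show thesis
    using that g by metis
qed

lemma h_ext_difference_imp_double_difference:
  assumes "degree p = 2" "degree q = 2"
    and "is_pq_difference_in_End p q (scale_sum_dual scale) (sum_dual scale) (h_ext u)"
  shows "is_pq_difference_in_End p q pair.scale UNIV double"
proof -
  obtain f1 f2 where f: "f1 \<in> End_on (scale_sum_dual scale) (sum_dual scale)"
      "f2 \<in> End_on (scale_sum_dual scale) (sum_dual scale)"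
      "\<And>w. w \<in> sum_dual scale \<Longrightarrow> h_ext u w = f1 w - f2 w"
      "\<And>w. w \<in> sum_dual scale \<Longrightarrow> poly_end (scale_sum_dual scale) p f1 w = 0"
      "\<And>w. w \<in> sum_dual scale \<Longrightarrow> poly_end (scale_sum_dual scale) q f2 w = 0"
    using assms(3) unfolding is_pq_difference_in_End_def by blast
  obtain g1 where g1: "g1 \<in> End_on pair.scale UNIV" "\<And>e. to_sum_dual (g1 e) = f1 (to_sum_dual e)"
    "\<And>e. poly_end pair.scale p g1 e = 0"
    using pull_back_End[OF assms(1) f(1,4)] by blast
  obtain g2 where g2: "g2 \<in> End_on pair.scale UNIV" "\<And>e. to_sum_dual (g2 e) = f2 (to_sum_dual e)"
    "\<And>e. poly_end pair.scale q g2 e = 0"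
    using pull_back_End[OF assms(2) f(2,5)] by blast
  have "double e = g1 e - g2 e" for e
  proof -
    have "to_sum_dual (double e) + to_sum_dual (g2 e) = to_sum_dual (g1 e)"
      using f(3)[OF to_sum_dual_mem[of e]] by (simp add: h_ext_to_sum_dual g1(2) g2(2))
    then have "double e + g2 e = g1 e"
      by (simp only: to_sum_dual_inj flip: to_sum_dual_add)
    then show ?thesis
      by (simp add: eq_diff_eq)
  qed
  then show ?thesis
    unfolding is_pq_difference_in_End_def using g1 g2 by blast
qed

text \<open>On the doubled space both sides carry the same factor 4, from the degree 2 of the
  polynomials and from the doubling, so the inequality descends to \<open>u\<close>. The range of
  P^(k+1) sees exponents from k + 2 on, that of Q^k exponents from k + 1 on.\<close>

lemma h_ext_difference_imp_n_elem_div_le: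
  assumes p: "irreducible p" "p = [:n, - t, 1:]" and q: "q = [:- y, 1:] * [:- z, 1:]"
    and ne: "pcompose p [:y, 1:] \<noteq> pcompose p [:z, 1:]"
    and kill: "\<And>x. ev (pcompose p [:y, 1:] ^ N * pcompose p [:z, 1:] ^ N) x = 0"
    and diff: "is_pq_difference_in_End p q (scale_sum_dual scale) (sum_dual scale) (h_ext u)"
  shows "n_elem_div scale UNIV u (pcompose p [:y, 1:]) (Suc (Suc k))
    \<le> n_elem_div scale UNIV u (pcompose p [:z, 1:]) (Suc k)"
proof -
  let ?P = "pcompose p [:y, 1:]" and ?Q = "pcompose p [:z, 1:]"
  have P: "irreducible ?P" "lead_coeff ?P = 1" "degree ?P = 2"
    using irreducible_pcompose_shift[OF p(1)] by (simp_all add: p(2) pcompose_pCons)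
  have Q: "irreducible ?Q" "lead_coeff ?Q = 1" "degree ?Q = 2"
    using irreducible_pcompose_shift[OF p(1)] by (simp_all add: p(2) pcompose_pCons)
  interpret dbl: lin_endo pair.scale pair.Basis_pair double
    by (rule lin_endo_double)
  have "is_pq_difference_in_End p q pair.scale UNIV double"
    using diff by (intro h_ext_difference_imp_double_difference) (simp_all add: p(2) q)
  then obtain a b where "Vector_Spaces.linear pair.scale pair.scale a"
      "\<And>x. a (a x) = pair.scale t (a x) - pair.scale n x"
      "Vector_Spaces.linear pair.scale pair.scale b"
      "\<And>x. b (b x) = pair.scale (y + z) (b x) - pair.scale (y * z) x"
      "\<And>x. double x = a x - b x"
    using dbl.difference_iff[OF p(2) q] by blast
  then have "pair.p.dim ({e. dbl.ev ?P e = 0} \<inter> range (dbl.ev (?P ^ Suc k)))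
      \<le> pair.p.dim ({e. dbl.ev ?Q e = 0} \<inter> range (dbl.ev (?Q ^ k)))"
    by (rule dbl.difference_dim_le[OF p(2) ne P(1) Q(1)])
  then show ?thesis
    using P Q unfolding dim_kernel_inter_range_double
      dim_kernel_inter_range_eq_n_elem_div[OF P(1,2) Q(1,2) ne kill P(1,2)]
      dim_kernel_inter_range_eq_n_elem_div[OF P(1,2) Q(1,2) ne kill Q(1,2)]
    by simp
qed

end

section \<open>The cycle of implications (iii), (i), (ii), (iv), (iii)\<close>

theorem theorem4p9:
  fixes p q :: "'a::field poly"
    and y1 y2 :: 'a
    and scale :: "'a \<Rightarrow> 'b::ab_group_add \<Rightarrow> 'b"
    and Basis :: "'b set"
    and v :: "'b \<Rightarrow> 'b"
  assumes "lead_coeff p = 1" and "degree p = 2"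
    and "lead_coeff q = 1" and "degree q = 2"
    and "irreducible p"
    and "q = [:- y1, 1:] * [:- y2, 1:]"
    and "pcompose p [:y1, 1:] \<noteq> pcompose p [:y2, 1:]"
    and "finite_dimensional_vector_space scale Basis"
    and "Vector_Spaces.linear scale scale v"
    and "pq_exceptional p q scale Basis v"
  defines "cond_i \<equiv> is_symplectic_pq_difference p q (scale_sum_dual scale) (sum_dual scale)
                       (symplectic_extension v)"
    and "cond_ii \<equiv> is_pq_difference_in_End p q (scale_sum_dual scale) (sum_dual scale) (h_ext v)"
    and "cond_iii \<equiv> is_pq_difference_in_End p q scale UNIV v"
    and "cond_iv \<equiv> intertwined 1 (n_elem_div scale UNIV v (pcompose p [:y1, 1:]))
                                  (n_elem_div scale UNIV v (pcompose p [:y2, 1:]))"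
  shows "(cond_i \<longleftrightarrow> cond_ii) \<and> (cond_ii \<longleftrightarrow> cond_iii) \<and> (cond_iii \<longleftrightarrow> cond_iv)"
proof -
  interpret lin_endo scale Basis v
    using assms(8,9) by (simp add: lin_endo_def lin_endo_axioms_def)
  let ?P = "pcompose p [:y1, 1:]" and ?Q = "pcompose p [:y2, 1:]"
  \<comment> \<open>Up to the usual signs of Vieta's formulas: \<open>n\<close> is the product and
    \<open>t\<close> the sum of the roots of p.\<close>
  define n where "n = coeff p 0"
  define t where "t = - coeff p 1"
  have p: "p = [:n, - t, 1:]"
    using monic_degree_2_eq[OF assms(2,1)] by (simp add: n_def t_def)
  have P: "irreducible ?P" "lead_coeff ?P = 1"
    using irreducible_pcompose_shift[OF assms(5)] by (simp_all add: p pcompose_pCons)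
  have Q: "irreducible ?Q" "lead_coeff ?Q = 1"
    using irreducible_pcompose_shift[OF assms(5)] by (simp_all add: p pcompose_pCons)
  obtain N where kill: "\<And>x. ev (?P ^ N * ?Q ^ N) x = 0"
    using exceptional_imp_annihilated assms(6,10) by blast
  \<comment> \<open>Exchanging y1 and y2 gives the second inequality of the intertwining condition
    from the same lemma.\<close>
  have kill': "\<And>x. ev (?Q ^ N * ?P ^ N) x = 0"
    using kill by (simp add: mult.commute)
  have q': "q = [:- y2, 1:] * [:- y1, 1:]"
    using assms(6) by (simp only: mult.commute)
  have "cond_iii \<Longrightarrow> cond_i"
    unfolding cond_iii_def cond_i_def by (rule difference_imp_symplectic_difference[OF assms(2,4)])
  moreover have "cond_i \<Longrightarrow> cond_ii"
    unfolding cond_i_def cond_ii_def is_symplectic_pq_difference_def symplectic_extension_def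
      alternating_End_def is_pq_difference_in_End_def by auto
  moreover have "cond_ii \<Longrightarrow> cond_iv"
  proof -
    assume "cond_ii"
    then have diff: "is_pq_difference_in_End p q (scale_sum_dual scale) (sum_dual scale) (h_ext v)"
      by (simp only: cond_ii_def)
    \<comment> \<open>Intertwining is indexed from 1 while the dimension estimate starts at 0, hence
      the instance \<open>k - 1\<close>.\<close>
    have "n_elem_div scale UNIV v ?P (k + 1) \<le> n_elem_div scale UNIV v ?Q k
        \<and> n_elem_div scale UNIV v ?Q (k + 1) \<le> n_elem_div scale UNIV v ?P k" if "k \<ge> 1" for k
      using h_ext_difference_imp_n_elem_div_le[OF assms(5) p assms(6,7) kill diff, of "k - 1"]
        h_ext_difference_imp_n_elem_div_le[OF assms(5) p q' assms(7)[symmetric] kill' diff, of "k - 1"] that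
      by simp
    then show cond_iv
      by (simp add: cond_iv_def intertwined_def)
  qed
  moreover have "cond_iv \<Longrightarrow> cond_iii"
  proof -
    assume "cond_iv"
    then obtain b where b: "Vector_Spaces.linear scale scale b"
      "\<And>x. b (b x) = scale (y1 + y2) (b x) - scale (y1 * y2) x"
      "\<And>x. v (v x + b x) + b (v x + b x) = scale t (v x + b x) - scale n x"
      using intertwined_imp_difference[OF P _ Q _ assms(7) kill, of n t] p
      unfolding cond_iv_def by metis
    interpret b: Vector_Spaces.linear scale scale b
      by (rule b(1))
    \<comment> \<open>The endomorphism v + b is the first term of the difference, with
      \<open>b\<close> as the second.\<close>
    have "Vector_Spaces.linear scale scale (\<lambda>x. v x + b x)"
      by (rule linear_endoI) (simp_all add: u.add u.scale b.add b.scale scale_right_distrib)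
    then show cond_iii
      unfolding cond_iii_def difference_iff[OF p assms(6)]
      by (intro exI[of _ "\<lambda>x. v x + b x"] exI[of _ b]) (simp add: b)
  qed
  ultimately show ?thesis
    by blast
qed

end
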